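(* Let $\omega_0\in\mathbb{R}$. Consider the power system dynamics $\tfrac{d}{dt}x=f(x,u)$ defined in the context, a solution $(i_s,v)\in\mathcal{P}_{\omega_0}$ to the nodal current balance equations $(-i_s,0_{2n_l})=Y_Nv$, and $i_T=Z_T^{-1}\mathcal{E}^\top v$. Let $(\theta,\omega,i)$ be a machine state with stator currents $i_s$ and let $u=(\tau_m,v_f)$ be the input. The power system operates in (synchronous) steady state with frequency $\omega_0$ from the state $x=(\theta,\omega,i,v,i_T)$ if and only if: 1. the machine state $(\theta,\omega,i)$, the input $u$, and $(i_s,v)$ satisfy, for every $k\in\{1,\dots,n_g\}$ and some rotor polarization $\sigma_k\in\{-1,1\}$, $$\omega_0l_{sf,k}i_{f,k}=\sigma_k\|\nu_k(\theta_k)\|,\qquad j\,\mathrm{r}(\theta_k)\|\nu_k(\theta_k)\|=\sigma_k\nu_k(\theta_k),$$ $$\omega_k=\omega_0,\qquad i_{d,k}=i_{q,k}=0,\qquad v_{f,k}=r_{f,k}i_{f,k},\qquad\tau_{m,k}=d_k\omega_0+\tau_{e,k},$$ where $\nu_k(\theta_k)=v_k-\big(r_{s,k}I_2+\omega_0\,j\,L_{s,k}(\theta_k)\big)i_{s,k}$; 2. the input $u$ is constant (in time); 3. the load model can be written as $i_{l,k}=Y_{l,k}(\|v_k\|)\,v_k$ for every $k\in\{1,\dots,n_v\}$.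
   Context: Notation. $(a,b)$ denotes stacked column vectors; $\mathrm{diag}$ denotes (block-)diagonal matrices; $\otimes$ is the Kronecker product; $\|\cdot\|$ is the Euclidean norm. $\mathrm{R}(\theta)=\begin{bmatrix}\cos\theta&-\sin\theta\\ \sin\theta&\cos\theta\end{bmatrix}$, $\mathrm{r}(\theta)=(\cos\theta,\sin\theta)$, $j=\mathrm{R}(\pi/2)$, $\mathsf{J}=\mathrm{diag}(j,0_{3\times3})\in\mathbb{R}^{5\times5}$. Sizes. There are $n_g$ generators, $n_v\ge n_g$ buses (generator $k$ is attached to bus $k$), $n_l=n_v-n_g$, and $n_t$ transmission lines. $E\in\{-1,0,1\}^{n_v\times n_t}$ is the oriented incidence matrix of the network graph (buses are nodes, lines are edges) and $\mathcal{E}=E\otimes I_2$. State and input. $x=(\theta,\omega,i,v,i_T)$, with rotor angles $\theta_k$, rotor speeds $\omega_k\in\mathbb{R}$, machine currents $i_k=(i_{s,k},i_{f,k},i_{d,k},i_{q,k})\in\mathbb{R}^5$ ($i_{s,k}\in\mathbb{R}^2$ stator current; $i_{f,k},i_{d,k},i_{q,k}\in\mathbb{R}$), $k=1,\dots,n_g$; $i_s=(i_{s,1},\dots,i_{s,n_g})\in\mathbb{R}^{2n_g}$; bus voltages $v_k\in\mathbb{R}^2$, $k=1,\dots,n_v$; line currents $i_{T,k}\in\mathbb{R}^2$, $k=1,\dots,n_t$. The input is $u=(\tau_m,v_f)\in\mathbb{R}^{2n_g}$ (mechanical torques, excitation voltages). Parameters. $M=\mathrm{diag}(m_k)$, $D=\mathrm{diag}(d_k)$,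 $m_k,d_k>0$; $R=\mathrm{diag}(R_1,\dots,R_{n_g})$ with $R_k=\mathrm{diag}(r_{s,k},r_{s,k},r_{f,k},r_{d,k},r_{q,k})$, all entries positive; $C=\mathrm{diag}(c_kI_2)$, $R_T=\mathrm{diag}(r_{T,k}I_2)$, $L_T=\mathrm{diag}(l_{T,k}I_2)$, $c_k,r_{T,k},l_{T,k}>0$. $L(\theta)=\mathrm{diag}(L_1(\theta_1),\dots,L_{n_g}(\theta_{n_g}))$ with $$L_k(\theta_k)=\begin{bmatrix}L_{s,k}(\theta_k)&L_{m,k}(\theta_k)\\L_{m,k}(\theta_k)^\top&L_{r,k}\end{bmatrix},\quad L_{r,k}=\begin{bmatrix}l_{f,k}&l_{fd,k}&0\\l_{fd,k}&l_{d,k}&0\\0&0&l_{q,k}\end{bmatrix},$$ $L_{s,k}(\theta_k)=l_{s,k}I_2+\mathrm{R}(2\theta_k)\,\mathrm{diag}(l_{sa,k},-l_{sa,k})$, $L_{m,k}(\theta_k)=\mathrm{R}(\theta_k)\begin{bmatrix}l_{sf,k}&l_{sd,k}&0\\0&0&-l_{sq,k}\end{bmatrix}$, with $l_{sa,k}\ge0$, all other inductance constants positive, and $L_k(\theta_k)$ invertible. Torque and induced voltage: $\tau_{e,k}=\tfrac12 i_k^\top(L_k(\theta_k)\mathsf{J}+\mathsf{J}^\top L_k(\theta_k))i_k$ and $v_{\mathrm{ind},k}=\omega_k(L_k(\theta_k)\mathsf{J}^\top+\mathsf{J}L_k(\theta_k))i_k$; $\tau_e,v_{\mathrm{ind}}$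 are the stacked vectors. Loads. The loads are static: $i_l(v)=(i_{l,1}(v_1),\dots,i_{l,n_v}(v_{n_v}))$ with (differentiable) $i_{l,k}:\mathbb{R}^2\to\mathbb{R}^2$ satisfying $i_{l,k}(v_k)^\top v_k\ge0$ and $i_{l,k}(0)=0$. The nodal current balance equations below are formulated under the standing restriction to load currents of the form $i_l(v)=Y_l(v)v$, where $Y_l(v)=\mathrm{diag}(Y_{l,1}(\|v_1\|),\dots,Y_{l,n_v}(\|v_{n_v}\|))$ and $Y_{l,k}(\|v_k\|)=I_2g_k(\|v_k\|)+j\,b_k(\|v_k\|)$ with $g_k:\mathbb{R}_{\ge0}\to\mathbb{R}_{\ge0}$, $b_k:\mathbb{R}_{\ge0}\to\mathbb{R}$. Condition 3 records this same load form in the list of conditions. Selection matrices: $\mathcal{I}_f=I_{n_g}\otimes(0,0,1,0,0)$ (column), $\mathcal{I}_s=I_{n_g}\otimes\begin{bmatrix}I_2\\0_{3\times2}\end{bmatrix}$, $\mathcal{I}_v^\top=[\mathcal{I}_s\;\;0_{5n_g\times2n_l}]$. $J_v=I_{n_v}\otimes j$, $J_T=I_{n_t}\otimes j$, $\mathcal{J}_g=I_{n_g}\otimes\mathsf{J}$. Power system dynamics: $\tfrac{d}{dt}x=f(x,u)$ with $\mathcal{M}(x)=\mathrm{diag}(I_{n_g},M,L(\theta),C,L_T)$ and $$f(x,u)=\mathcal{M}(x)^{-1}\begin{bmatrix}\omega\\-D\omega-\tau_e+\tau_m\\-Ri+\mathcal{I}_v^\top v+\mathcal{I}_fv_f-v_{\mathrm{ind}}\\-\mathcal{I}_vi-\mathcal{E}i_T-i_l(v)\\-R_Ti_T+\mathcal{E}^\top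 v\end{bmatrix}.$$ Synchronous steady-state dynamics: $f_d(x,\omega_0)=(\omega_0\mathbf{1}_{n_g},0,\omega_0\mathcal{J}_gi,\omega_0J_vv,\omega_0J_Ti_T)$. The system "operates in steady state" from a state $x$ if the trajectory of $\tfrac{d}{dt}x=f(x,u)$ starting at $x$ (with the given input) coincides with the synchronous steady-state behavior for all time, i.e. $f(x(t),u(t))=f_d(x(t),\omega_0)$ for all times $t$. Condition 1 refers to the starting state and the input at the starting time. Nodal current balance equations: with the branch impedance matrix $Z_T=R_T+\omega_0J_TL_T$ (invertible), the shunt load admittance matrix $Y_v=Y_l(v)+\omega_0J_vC$, and the network admittance matrix $Y_N=Y_v+\mathcal{E}Z_T^{-1}\mathcal{E}^\top$, $$\mathcal{P}_{\omega_0}=\{(i_s,v)\in\mathbb{R}^{2n_g}\times\mathbb{R}^{2n_v}:(-i_s,0_{2n_l})=Y_Nv\}.$$ *)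

theory Defs
  imports "HOL-Analysis.Analysis"
begin

section \<open>Block vectors and matrices\<close>

text \<open>
  A vector stacked from blocks indexed by \<open>'k\<close> is indexed by pairs \<open>'k \<times> 'a\<close> (first component:
  block, second component: position inside the block). A vector \<open>(a, b)\<close> of two blocks of
  different size is indexed by a sum type.
\<close>

definition stack :: "('k \<Rightarrow> real ^ 'a) \<Rightarrow> real ^ ('k::finite \<times> 'a::finite)" where
  "stack x = (\<chi> p. x (fst p) $ snd p)"

definition block :: "'k \<Rightarrow> real ^ ('k::finite \<times> 'a::finite) \<Rightarrow> real ^ 'a" where
  "block k x = (\<chi> a. x $ (k, a))"

definition diag_mat :: "('k::finite \<Rightarrow> real) \<Rightarrow> real ^ 'k ^ 'k" where
  "diag_mat d = (\<chi> i j. if i = j then d i else 0)"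

definition block_diag ::
  "('k \<Rightarrow> real ^ 'b ^ 'a) \<Rightarrow> real ^ ('k::finite \<times> 'b::finite) ^ ('k \<times> 'a::finite)" where
  "block_diag A = (\<chi> p q. if fst p = fst q then A (fst p) $ snd p $ snd q else 0)"

definition block_mat ::
  "real ^ 'a ^ 'c \<Rightarrow> real ^ 'b ^ 'c \<Rightarrow> real ^ 'a ^ 'd \<Rightarrow> real ^ 'b ^ 'd
     \<Rightarrow> real ^ ('a::finite + 'b::finite) ^ ('c::finite + 'd::finite)" where
  "block_mat A B C D =
     (\<chi> p q. case p of
         Inl i \<Rightarrow> (case q of Inl j \<Rightarrow> A $ i $ j | Inr j \<Rightarrow> B $ i $ j)
       | Inr i \<Rightarrow> (case q of Inl j \<Rightarrow> C $ i $ j | Inr j \<Rightarrow> D $ i $ j))"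

definition kron ::
  "real ^ 'n ^ 'm \<Rightarrow> real ^ 'b ^ 'a \<Rightarrow> real ^ ('n::finite \<times> 'b::finite) ^ ('m::finite \<times> 'a::finite)"
  where "kron A B = (\<chi> p q. A $ fst p $ fst q * B $ snd p $ snd q)"

text \<open>Kronecker product with a single column.\<close>

definition kron_col :: "real ^ 'n ^ 'm \<Rightarrow> real ^ 'a \<Rightarrow> real ^ 'n::finite ^ ('m::finite \<times> 'a::finite)"
  where "kron_col A c = (\<chi> p j. A $ fst p $ j * c $ snd p)"

definition rot :: "real \<Rightarrow> real ^ 2 ^ 2" where
  "rot \<theta> = vector [vector [cos \<theta>, - sin \<theta>], vector [sin \<theta>, cos \<theta>]]"

definition rvec :: "real \<Rightarrow> real ^ 2" where
  "rvec \<theta> = vector [cos \<theta>, sin \<theta>]"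

definition jmat :: "real ^ 2 ^ 2" where
  "jmat = rot (pi / 2)"

definition Jmat :: "real ^ (2 + 3) ^ (2 + 3)" where
  "Jmat = block_mat jmat 0 0 0"


section \<open>Power system data\<close>

text \<open>
  Generators, buses and lines are indexed by the finite types \<open>'g\<close>, \<open>'v\<close> and \<open>'t\<close>. Generator \<open>k\<close>
  is attached to the bus \<open>gen_bus k\<close>; this map is injective, but need not be surjective, and the
  buses outside its range are the load buses (there may be none).
  The loads are \<open>iload k\<close>, with conductance \<open>gload k\<close> and susceptance \<open>bload k\<close> as functions of
  the voltage magnitude.
\<close>

record ('g, 'v, 't) power_system =
  mass :: "'g \<Rightarrow> real"
  damping :: "'g \<Rightarrow> real"
  rs :: "'g \<Rightarrow> real"
  rf :: "'g \<Rightarrow> real"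
  rd :: "'g \<Rightarrow> real"
  rq :: "'g \<Rightarrow> real"
  ls :: "'g \<Rightarrow> real"
  lsa :: "'g \<Rightarrow> real"
  lsf :: "'g \<Rightarrow> real"
  lsd :: "'g \<Rightarrow> real"
  lsq :: "'g \<Rightarrow> real"
  lf :: "'g \<Rightarrow> real"
  lfd :: "'g \<Rightarrow> real"
  ld :: "'g \<Rightarrow> real"
  lq :: "'g \<Rightarrow> real"
  gen_bus :: "'g \<Rightarrow> 'v"
  cap :: "'v \<Rightarrow> real"
  rT :: "'t \<Rightarrow> real"
  lT :: "'t \<Rightarrow> real"
  incidence :: "'v \<Rightarrow> 't \<Rightarrow> real"
  iload :: "'v \<Rightarrow> real ^ 2 \<Rightarrow> real ^ 2"
  gload :: "'v \<Rightarrow> real \<Rightarrow> real"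
  bload :: "'v \<Rightarrow> real \<Rightarrow> real"

definition Ls :: "('g, 'v, 't) power_system \<Rightarrow> 'g \<Rightarrow> real \<Rightarrow> real ^ 2 ^ 2" where
  "Ls P k \<theta> = ls P k *\<^sub>R mat 1
     + rot (2 * \<theta>) ** vector [vector [lsa P k, 0], vector [0, - lsa P k]]"

definition Lm :: "('g, 'v, 't) power_system \<Rightarrow> 'g \<Rightarrow> real \<Rightarrow> real ^ 3 ^ 2" where
  "Lm P k \<theta> = rot \<theta> ** vector [vector [lsf P k, lsd P k, 0], vector [0, 0, - lsq P k]]"

definition Lr :: "('g, 'v, 't) power_system \<Rightarrow> 'g \<Rightarrow> real ^ 3 ^ 3" where
  "Lr P k = vector [vector [lf P k, lfd P k, 0],
                    vector [lfd P k, ld P k, 0],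
                    vector [0, 0, lq P k]]"

definition Lk :: "('g, 'v, 't) power_system \<Rightarrow> 'g \<Rightarrow> real \<Rightarrow> real ^ (2 + 3) ^ (2 + 3)" where
  "Lk P k \<theta> = block_mat (Ls P k \<theta>) (Lm P k \<theta>) (transpose (Lm P k \<theta>)) (Lr P k)"

definition Rk :: "('g, 'v, 't) power_system \<Rightarrow> 'g \<Rightarrow> real ^ (2 + 3) ^ (2 + 3)" where
  "Rk P k = block_mat (rs P k *\<^sub>R mat 1) 0 0
     (vector [vector [rf P k, 0, 0], vector [0, rd P k, 0], vector [0, 0, rq P k]])"

definition load_admittance :: "(real \<Rightarrow> real) \<Rightarrow> (real \<Rightarrow> real) \<Rightarrow> real \<Rightarrow> real ^ 2 ^ 2" where
  "load_admittance g b r = g r *\<^sub>R mat 1 + b r *\<^sub>R jmat"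

definition admittance_load ::
  "(real ^ 2 \<Rightarrow> real ^ 2) \<Rightarrow> (real \<Rightarrow> real) \<Rightarrow> (real \<Rightarrow> real) \<Rightarrow> bool" where
  "admittance_load il g b \<longleftrightarrow>
     (\<forall>r\<ge>0. g r \<ge> 0) \<and> (\<forall>w. il w = load_admittance g b (norm w) *v w)"

text \<open>Each edge leaves one node (entry 1) and enters a different one (entry -1).\<close>

definition oriented_incidence :: "('v \<Rightarrow> 't \<Rightarrow> real) \<Rightarrow> bool" where
  "oriented_incidence E \<longleftrightarrow>
     (\<forall>l. \<exists>a b. a \<noteq> b \<and> (\<forall>k. E k l = (if k = a then 1 else if k = b then - 1 else 0)))"

definition wf_power_system :: "('g, 'v, 't) power_system \<Rightarrow> bool" where
  "wf_power_system P \<longleftrightarrow>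
     (\<forall>k. mass P k > 0 \<and> damping P k > 0) \<and>
     (\<forall>k. rs P k > 0 \<and> rf P k > 0 \<and> rd P k > 0 \<and> rq P k > 0) \<and>
     (\<forall>k. lsa P k \<ge> 0 \<and> ls P k > 0 \<and> lsf P k > 0 \<and> lsd P k > 0 \<and> lsq P k > 0 \<and>
          lf P k > 0 \<and> lfd P k > 0 \<and> ld P k > 0 \<and> lq P k > 0) \<and>
     (\<forall>k \<theta>. invertible (Lk P k \<theta>)) \<and>
     (\<forall>k. cap P k > 0) \<and>
     (\<forall>l. rT P l > 0 \<and> lT P l > 0) \<and>
     inj (gen_bus P) \<and>
     oriented_incidence (incidence P) \<and>
     (\<forall>k w. iload P k differentiable (at w)) \<and>
     (\<forall>k w. iload P k w \<bullet> w \<ge> 0) \<and>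
     (\<forall>k. iload P k 0 = 0) \<and>
     (\<forall>k. admittance_load (iload P k) (gload P k) (bload P k))"


section \<open>Stacked matrices\<close>

definition Mmat :: "('g::finite, 'v, 't) power_system \<Rightarrow> real ^ 'g ^ 'g" where
  "Mmat P = diag_mat (mass P)"

definition Dmat :: "('g::finite, 'v, 't) power_system \<Rightarrow> real ^ 'g ^ 'g" where
  "Dmat P = diag_mat (damping P)"

definition Rmat ::
  "('g::finite, 'v, 't) power_system \<Rightarrow> real ^ ('g \<times> (2 + 3)) ^ ('g \<times> (2 + 3))" where
  "Rmat P = block_diag (Rk P)"

definition Lmat ::
  "('g::finite, 'v, 't) power_system \<Rightarrow> real ^ 'g \<Rightarrow> real ^ ('g \<times> (2 + 3)) ^ ('g \<times> (2 + 3))" where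
  "Lmat P \<theta> = block_diag (\<lambda>k. Lk P k (\<theta> $ k))"

definition Cmat :: "('g, 'v::finite, 't) power_system \<Rightarrow> real ^ ('v \<times> 2) ^ ('v \<times> 2)" where
  "Cmat P = block_diag (\<lambda>k. cap P k *\<^sub>R mat 1)"

definition RTmat :: "('g, 'v, 't::finite) power_system \<Rightarrow> real ^ ('t \<times> 2) ^ ('t \<times> 2)" where
  "RTmat P = block_diag (\<lambda>l. rT P l *\<^sub>R mat 1)"

definition LTmat :: "('g, 'v, 't::finite) power_system \<Rightarrow> real ^ ('t \<times> 2) ^ ('t \<times> 2)" where
  "LTmat P = block_diag (\<lambda>l. lT P l *\<^sub>R mat 1)"

definition Emat :: "('g, 'v::finite, 't::finite) power_system \<Rightarrow> real ^ ('t \<times> 2) ^ ('v \<times> 2)" where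
  "Emat P = kron (\<chi> k l. incidence P k l) (mat 1)"

text \<open>
  With generator buses numbered first, \<open>attach P\<close> is the matrix with blocks \<open>I, 0\<close> stacked on top of
  each other, so that \<open>Iv P\<close> is \<open>[I, 0]\<close> (size 2 by 5) at the generator buses and zero at the
  load buses.
\<close>

definition attach :: "('g::finite, 'v::finite, 't) power_system \<Rightarrow> real ^ 'g ^ 'v" where
  "attach P = (\<chi> b k. if b = gen_bus P k then 1 else 0)"

definition Iv :: "('g::finite, 'v::finite, 't) power_system \<Rightarrow> real ^ ('g \<times> (2 + 3)) ^ ('v \<times> 2)" where
  "Iv P = kron (attach P) (\<chi> a q. case q of Inl b \<Rightarrow> mat 1 $ a $ b | Inr _ \<Rightarrow> 0)"

definition Isel_f :: "real ^ 'g::finite ^ ('g \<times> (2 + 3))" where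
  "Isel_f = kron_col (mat 1) (axis (Inr 1) 1)"

text \<open>\<open>J2\<close> is \<open>J\<^sub>v\<close> at index type \<open>'v\<close> and \<open>J\<^sub>T\<close> at index type \<open>'t\<close>.\<close>

definition J2 :: "real ^ ('k::finite \<times> 2) ^ ('k \<times> 2)" where
  "J2 = kron (mat 1) jmat"

definition Jg :: "real ^ ('g::finite \<times> (2 + 3)) ^ ('g \<times> (2 + 3))" where
  "Jg = kron (mat 1) Jmat"


section \<open>Dynamics\<close>

text \<open>
  The state is \<open>(\<theta>, \<omega>, i, v, i\<^sub>T)\<close>. In \<open>i\<close>, the entries \<open>(k, Inl 1)\<close>, \<open>(k, Inl 2)\<close> are the stator
  currents of machine \<open>k\<close>, and \<open>(k, Inr 1)\<close>, \<open>(k, Inr 2)\<close>, \<open>(k, Inr 3)\<close> its f, d and q rotor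
  currents. The input is \<open>(\<tau>\<^sub>m, v\<^sub>f)\<close>.
\<close>

type_synonym ('g, 'v, 't) state =
  "(real ^ 'g) \<times> (real ^ 'g) \<times> (real ^ ('g \<times> (2 + 3))) \<times> (real ^ ('v \<times> 2)) \<times> (real ^ ('t \<times> 2))"

type_synonym 'g input = "(real ^ 'g) \<times> (real ^ 'g)"

definition torque ::
  "('g::finite, 'v, 't) power_system \<Rightarrow> real ^ 'g \<Rightarrow> real ^ ('g \<times> (2 + 3)) \<Rightarrow> real ^ 'g" where
  "torque P \<theta> i = (\<chi> k. 1 / 2 *
     (block k i \<bullet> ((Lk P k (\<theta> $ k) ** Jmat + transpose Jmat ** Lk P k (\<theta> $ k)) *v block k i)))"

definition v_ind ::
  "('g::finite, 'v, 't) power_system \<Rightarrow> real ^ 'g \<Rightarrow> real ^ 'g \<Rightarrow> real ^ ('g \<times> (2 + 3))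
     \<Rightarrow> real ^ ('g \<times> (2 + 3))" where
  "v_ind P \<theta> \<omega> i = stack (\<lambda>k. \<omega> $ k *\<^sub>R
     ((Lk P k (\<theta> $ k) ** transpose Jmat + Jmat ** Lk P k (\<theta> $ k)) *v block k i))"

definition load_current ::
  "('g, 'v::finite, 't) power_system \<Rightarrow> real ^ ('v \<times> 2) \<Rightarrow> real ^ ('v \<times> 2)" where
  "load_current P v = stack (\<lambda>k. iload P k (block k v))"

text \<open>The inverse of the block-diagonal mass matrix is applied block by block.\<close>

definition vector_field ::
  "('g::finite, 'v::finite, 't::finite) power_system \<Rightarrow> ('g, 'v, 't) state \<Rightarrow> 'g input
     \<Rightarrow> ('g, 'v, 't) state" where
  "vector_field P = (\<lambda>(\<theta>, \<omega>, i, v, iT) (\<tau>m, vf).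
     (\<omega>,
      matrix_inv (Mmat P) *v (- (Dmat P *v \<omega>) - torque P \<theta> i + \<tau>m),
      matrix_inv (Lmat P \<theta>) *v
        (- (Rmat P *v i) + transpose (Iv P) *v v + Isel_f *v vf - v_ind P \<theta> \<omega> i),
      matrix_inv (Cmat P) *v (- (Iv P *v i) - Emat P *v iT - load_current P v),
      matrix_inv (LTmat P) *v (- (RTmat P *v iT) + transpose (Emat P) *v v)))"

definition sync_field ::
  "real \<Rightarrow> ('g::finite, 'v::finite, 't::finite) state \<Rightarrow> ('g, 'v, 't) state" where
  "sync_field \<omega>0 = (\<lambda>(\<theta>, \<omega>, i, v, iT).
     ((\<chi> k. \<omega>0), 0, \<omega>0 *\<^sub>R (Jg *v i), \<omega>0 *\<^sub>R (J2 *v v), \<omega>0 *\<^sub>R (J2 *v iT)))"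

definition trajectory ::
  "('g::finite, 'v::finite, 't::finite) power_system \<Rightarrow> (real \<Rightarrow> 'g input) \<Rightarrow> ('g, 'v, 't) state
     \<Rightarrow> (real \<Rightarrow> ('g, 'v, 't) state) \<Rightarrow> bool" where
  "trajectory P u x0 x \<longleftrightarrow> x 0 = x0 \<and>
     (\<forall>t\<ge>0. (x has_vector_derivative vector_field P (x t) (u t)) (at t within {0..}))"

text \<open>
  ``The trajectory starting at \<open>x0\<close> has the property'' is rendered as: a trajectory exists for all
  \<open>t \<ge> 0\<close>, and every such trajectory has the property.
\<close>

definition operates_in_steady_state ::
  "('g::finite, 'v::finite, 't::finite) power_system \<Rightarrow> real \<Rightarrow> (real \<Rightarrow> 'g input)
     \<Rightarrow> ('g, 'v, 't) state \<Rightarrow> bool" where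
  "operates_in_steady_state P \<omega>0 u x0 \<longleftrightarrow>
     (\<exists>x. trajectory P u x0 x) \<and>
     (\<forall>x. trajectory P u x0 x \<longrightarrow>
        (\<forall>t\<ge>0. vector_field P (x t) (u t) = sync_field \<omega>0 (x t)))"


section \<open>Nodal current balance\<close>

definition ZT :: "('g, 'v, 't::finite) power_system \<Rightarrow> real \<Rightarrow> real ^ ('t \<times> 2) ^ ('t \<times> 2)" where
  "ZT P \<omega>0 = RTmat P + \<omega>0 *\<^sub>R (J2 ** LTmat P)"

definition Yl ::
  "('g, 'v::finite, 't) power_system \<Rightarrow> real ^ ('v \<times> 2) \<Rightarrow> real ^ ('v \<times> 2) ^ ('v \<times> 2)" where
  "Yl P v = block_diag (\<lambda>k. load_admittance (gload P k) (bload P k) (norm (block k v)))"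

definition Yv ::
  "('g, 'v::finite, 't) power_system \<Rightarrow> real \<Rightarrow> real ^ ('v \<times> 2) \<Rightarrow> real ^ ('v \<times> 2) ^ ('v \<times> 2)" where
  "Yv P \<omega>0 v = Yl P v + \<omega>0 *\<^sub>R (J2 ** Cmat P)"

definition YN ::
  "('g, 'v::finite, 't::finite) power_system \<Rightarrow> real \<Rightarrow> real ^ ('v \<times> 2)
     \<Rightarrow> real ^ ('v \<times> 2) ^ ('v \<times> 2)" where
  "YN P \<omega>0 v = Yv P \<omega>0 v + Emat P ** matrix_inv (ZT P \<omega>0) ** transpose (Emat P)"

definition nodal_balance ::
  "('g::finite, 'v::finite, 't::finite) power_system \<Rightarrow> real
     \<Rightarrow> ((real ^ ('g \<times> 2)) \<times> (real ^ ('v \<times> 2))) set" where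
  "nodal_balance P \<omega>0 = {(i_s, v). kron (attach P) (mat 1) *v (- i_s) = YN P \<omega>0 v *v v}"

definition stator_currents :: "real ^ ('g::finite \<times> (2 + 3)) \<Rightarrow> real ^ ('g \<times> 2)" where
  "stator_currents i = (\<chi> p. i $ (fst p, Inl (snd p)))"

definition nu ::
  "('g::finite, 'v::finite, 't) power_system \<Rightarrow> real \<Rightarrow> real ^ ('g \<times> 2) \<Rightarrow> real ^ ('v \<times> 2)
     \<Rightarrow> 'g \<Rightarrow> real \<Rightarrow> real ^ 2" where
  "nu P \<omega>0 i_s v k \<theta> =
     block (gen_bus P k) v - (rs P k *\<^sub>R mat 1 + \<omega>0 *\<^sub>R (jmat ** Ls P k \<theta>)) *v block k i_s"

end

theory Submission
  imports Defs
begin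

text \<open>
  In a frame rotating with angular velocity \<open>\<omega>0\<close> (which shifts the rotor angles and rotates all stator,
  bus and line quantities) the dynamics is autonomous, because the vector field commutes with
  simultaneous rotations, and synchronous motions become equilibria. So steady state operation means
  that the vector field agrees with the synchronous one at the initial state and that the input does
  not change; at the initial state this is an algebraic identity that splits into the network part,
  which is the nodal balance, and one system of equations for each machine.

  The load currents are only assumed differentiable, so the vector field need not be locally Lipschitz.
  Uniqueness of the solution still holds since differentiability at the equilibrium of the rotating
  frame gives a linear bound there.
\<close>

section \<open>Equilibria and differentiability\<close>

text \<open>Near \<open>y0\<close> the field is bounded by a multiple of the distance to
  \<open>y0\<close>. The times with \<open>y t = y0\<close> form a closed set by continuity. Over a
  short interval around such a time the mean value inequality bounds the largest deviation by half
  of itself, so the set is also open in the half-line, which is connected.\<close>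

lemma stationary_unique:
  fixes h :: "'a::real_normed_vector \<Rightarrow> 'a"
  assumes diff: "h differentiable (at y0)" and zero: "h y0 = 0" and init: "y 0 = y0"
    and ode: "\<And>t. t \<ge> 0 \<Longrightarrow> (y has_vector_derivative h (y t)) (at t within {0..})"
    and t: "t \<ge> 0"
  shows "y t = y0"
proof -
  obtain h' where h': "(h has_derivative h') (at y0)"
    using diff by (auto simp: differentiable_def)
  obtain K where K: "K > 0" "\<And>w. norm (h' w) \<le> norm w * K"
    using bounded_linear.pos_bounded[OF has_derivative_bounded_linear[OF h']] by blast
  \<comment> \<open>In \<open>K + 1\<close>, the bound \<open>K\<close> comes from the derivative at
    \<open>y0\<close> and the 1 is the linearization error allowed inside the radius
    \<open>r\<close>.\<close>
  obtain r where r: "r > 0" and hr: "\<And>w. norm (w - y0) < r \<Longrightarrow> norm (h w) \<le> (K + 1) * norm (w - y0)"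
  proof -
    obtain r where r: "r > 0"
      "\<And>w. norm (w - y0) < r \<Longrightarrow> norm (h w - h y0 - h' (w - y0)) \<le> 1 * norm (w - y0)"
      using h' unfolding has_derivative_at_alt by (meson zero_less_one)
    have "norm (h w) \<le> (K + 1) * norm (w - y0)" if "norm (w - y0) < r" for w
      using norm_triangle_ineq[of "h w - h y0 - h' (w - y0)" "h' (w - y0)"] zero r(2)[OF that]
        K(2)[of "w - y0"] by (simp add: algebra_simps)
    with r(1) show thesis by (rule that)
  qed
  have cont: "continuous_on {0..} y"
    using ode has_vector_derivative_continuous by (force simp: continuous_on_eq_continuous_within)
  let ?T = "{s \<in> {0..}. y s = y0}"
  have "closedin (top_of_set {0..}) ?T"
    using cont by (rule continuous_closedin_preimage_constant)
  moreover have "openin (top_of_set {0..}) ?T"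
    unfolding openin_euclidean_subtopology_iff
  proof (intro conjI ballI)
    fix a assume a: "a \<in> ?T"
    obtain d where d: "d > 0" and yd: "\<And>s. s \<ge> 0 \<Longrightarrow> dist s a < d \<Longrightarrow> norm (y s - y0) < r"
      using cont a r unfolding continuous_on_iff by (force simp: dist_norm)
    \<comment> \<open>Staying below \<open>d\<close> keeps \<open>y\<close> in the ball of radius
      \<open>r\<close>; the second bound makes the mean value estimate a contraction by 1/2.\<close>
    define \<epsilon> where "\<epsilon> = min (d / 2) (1 / (2 * (K + 1)))"
    have \<epsilon>: "\<epsilon> > 0" "\<epsilon> < d" "(K + 1) * \<epsilon> \<le> 1 / 2"
    proof -
      show "\<epsilon> > 0" "\<epsilon> < d" using d K by (auto simp: \<epsilon>_def min_less_iff_disj)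
      have "(K + 1) * \<epsilon> \<le> (K + 1) * (1 / (2 * (K + 1)))"
        using K by (intro mult_left_mono) (auto simp: \<epsilon>_def)
      also have "\<dots> = 1 / 2" using K by (simp add: field_simps)
      finally show "(K + 1) * \<epsilon> \<le> 1 / 2" .
    qed
    \<comment> \<open>Cut off at 0, since the equation is given only for nonnegative times.\<close>
    let ?I = "{max 0 (a - \<epsilon>)..a + \<epsilon>}"
    have sub: "?I \<subseteq> {0..}" and aI: "a \<in> ?I" using a \<epsilon> by auto
    have "continuous_on ?I (\<lambda>s. norm (y s - y0))"
      using continuous_on_subset[OF cont sub] by (intro continuous_intros)
    then obtain p where p: "p \<in> ?I" "\<And>s. s \<in> ?I \<Longrightarrow> norm (y s - y0) \<le> norm (y p - y0)"
      using continuous_attains_sup[of ?I] aI by (metis compact_Icc empty_iff)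
    have "norm (y p - y a) \<le> ((K + 1) * norm (y p - y0)) * norm (p - a)"
    proof (rule differentiable_bound[where S = ?I and f' = "\<lambda>s x. x *\<^sub>R h (y s)"])
      fix s assume s: "s \<in> ?I"
      show "(y has_derivative (\<lambda>x. x *\<^sub>R h (y s))) (at s within ?I)"
        using ode[of s] s has_vector_derivative_within_subset[OF _ sub]
        by (auto simp: has_vector_derivative_def)
      have "norm (h (y s)) \<le> (K + 1) * norm (y s - y0)"
        using s \<epsilon> by (intro hr yd) (auto simp: dist_real_def)
      also have "\<dots> \<le> (K + 1) * norm (y p - y0)"
        using p(2)[OF s] K by (intro mult_left_mono) auto
      finally show "onorm (\<lambda>x. x *\<^sub>R h (y s)) \<le> (K + 1) * norm (y p - y0)"
        using K by (intro onorm_bound) (auto simp: mult.commute intro: mult_left_mono)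
    qed (use p aI in auto)
    also have "\<dots> \<le> ((K + 1) * norm (y p - y0)) * \<epsilon>"
      using p(1) \<epsilon> K by (intro mult_left_mono) (auto simp: abs_le_iff)
    also have "\<dots> = ((K + 1) * \<epsilon>) * norm (y p - y0)" by simp
    also have "\<dots> \<le> 1 / 2 * norm (y p - y0)" using \<epsilon> by (intro mult_right_mono) auto
    \<comment> \<open>With \<open>y a = y0\<close>, the maximal deviation is at most half of
      itself.\<close>
    finally have "norm (y p - y0) = 0" using a by simp
    then have "s \<in> ?T" if "s \<in> ?I" for s using p(2)[OF that] that sub by auto
    then show "\<exists>e>0. \<forall>x'\<in>{0..}. dist x' a < e \<longrightarrow> x' \<in> ?T"
      using \<epsilon> by (intro exI[of _ \<epsilon>]) (auto simp: dist_real_def abs_less_iff)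
  qed auto
  ultimately have "?T = {} \<or> ?T = {0..}"
    by (metis connected_Ici connected_clopen)
  then show ?thesis using init t by auto
qed

section \<open>Matrix inverses and their dependence on a parameter\<close>

lemma invertible_iff_ker:
  fixes A :: "real ^ 'n ^ 'n"
  shows "invertible A \<longleftrightarrow> (\<forall>x. A *v x = 0 \<longrightarrow> x = 0)"
  by (simp add: invertible_left_inverse matrix_left_invertible_ker)

lemma matrix_inv_mult_eq_iff:
  fixes A :: "real ^ 'n ^ 'n"
  assumes "invertible A"
  shows "matrix_inv A *v b = x \<longleftrightarrow> A *v x = b"
proof -
  have "A ** matrix_inv A = mat 1 \<and> matrix_inv A ** A = mat 1"
    using assms unfolding invertible_def matrix_inv_def by (rule someI_ex)
  then show ?thesis by (metis matrix_vector_mul_assoc matrix_vector_mul_lid)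
qed

lemma differentiable_vec_iff:
  fixes f :: "'a::real_normed_vector \<Rightarrow> real ^ 'n"
  shows "f differentiable (at x within S) \<longleftrightarrow> (\<forall>k. (\<lambda>y. f y $ k) differentiable (at x within S))"
proof safe
  fix k assume "f differentiable (at x within S)"
  then obtain f' where "(f has_derivative f') (at x within S)" by (auto simp: differentiable_def)
  then show "(\<lambda>y. f y $ k) differentiable (at x within S)"
    by (rule differentiableI[OF bounded_linear.has_derivative[OF bounded_linear_vec_nth]])
next
  assume f: "\<forall>k. (\<lambda>y. f y $ k) differentiable (at x within S)"
  have "(\<lambda>y. \<Sum>k\<in>UNIV. f y $ k *\<^sub>R (axis k 1 :: real ^ 'n)) differentiable (at x within S)"
    using f by (intro differentiable_sum differentiable_scaleR differentiable_const) auto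
  moreover have "(\<lambda>y. \<Sum>k\<in>UNIV. f y $ k *\<^sub>R (axis k 1 :: real ^ 'n)) = f"
    by (simp add: fun_eq_iff basis_expansion flip: scalar_mult_eq_scaleR)
  ultimately show "f differentiable (at x within S)" by simp
qed

lemma differentiable_prod:
  fixes f :: "'i \<Rightarrow> 'a::real_normed_vector \<Rightarrow> real"
  assumes "\<And>i. i \<in> I \<Longrightarrow> f i differentiable (at x within S)"
  shows "(\<lambda>x. \<Prod>i\<in>I. f i x) differentiable (at x within S)"
  using assms by (induction I rule: infinite_finite_induct) auto

lemma differentiable_det:
  fixes A :: "'a::real_normed_vector \<Rightarrow> real ^ 'n ^ 'n"
  assumes "\<And>i j. (\<lambda>x. A x $ i $ j) differentiable (at x within S)"
  shows "(\<lambda>x. det (A x)) differentiable (at x within S)"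
  unfolding det_def
  by (intro differentiable_sum ballI differentiable_mult differentiable_prod differentiable_const assms)
     (simp add: finite_permutations)

text \<open>Cramer's rule writes each entry as a quotient of determinants, which are polynomials in
  the entries, so inversion itself need not be differentiated.\<close>

lemma differentiable_matrix_inv_mult:
  fixes A :: "'a::real_normed_vector \<Rightarrow> real ^ 'n ^ 'n"
  assumes A: "\<And>i j. (\<lambda>x. A x $ i $ j) differentiable (at x within S)"
    and b: "\<And>i. (\<lambda>x. b x $ i) differentiable (at x within S)"
    and inv: "\<And>x. invertible (A x)"
  shows "(\<lambda>x. matrix_inv (A x) *v b x) differentiable (at x within S)"
proof -
  have nz: "det (A x) \<noteq> 0" for x using inv invertible_det_nz by blast
  have "(\<lambda>x. matrix_inv (A x) *v b x) =
      (\<lambda>x. \<chi> k. det (\<chi> i j. if j = k then b x $ i else A x $ i $ j) / det (A x))"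
    using cramer[OF nz] matrix_inv_mult_eq_iff[OF inv] by blast
  moreover have "(\<lambda>x. det (\<chi> i j. if j = k then b x $ i else A x $ i $ j) / det (A x))
      differentiable (at x within S)" for k
  proof (intro differentiable_divide differentiable_det A nz)
    show "(\<lambda>x. (\<chi> i j. if j = k then b x $ i else A x $ i $ j) $ i $ j)
        differentiable (at x within S)" for i j
      using A b by (cases "j = k") simp_all
  qed
  ultimately show ?thesis by (simp add: differentiable_vec_iff)
qed

text \<open>When \<open>J\<^sup>3 = - J\<close>, this is \<open>exp (\<alpha> J) x\<close>, by Rodrigues' formula.\<close>

definition rotv :: "real ^ 'n ^ 'n \<Rightarrow> real \<Rightarrow> real ^ 'n \<Rightarrow> real ^ 'n" where
  "rotv J \<alpha> x = x + sin \<alpha> *\<^sub>R (J *v x) + (1 - cos \<alpha>) *\<^sub>R (J *v (J *v x))"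

lemma rotv_zero [simp]: "rotv J 0 x = x"
  by (simp add: rotv_def)

lemma linear_rotv: "linear (rotv J \<alpha>)"
  by (rule linearI) (simp_all add: rotv_def matrix_vector_right_distrib
      matrix_vector_mult_scaleR algebra_simps)

text \<open>\<open>rotv\<close> is a polynomial in its generator, so a matrix that intertwines the
  generators also intertwines the rotations. Most symmetry arguments below reduce to this.\<close>

lemma rotv_mult:
  fixes A :: "real ^ 'n ^ 'm"
  assumes "\<And>x. A *v (J *v x) = J' *v (A *v x)"
  shows "rotv J' \<alpha> (A *v x) = A *v rotv J \<alpha> x"
  by (simp add: rotv_def matrix_vector_right_distrib matrix_vector_mult_scaleR assms)

lemma rotv_generator: "rotv J \<alpha> (J *v x) = J *v rotv J \<alpha> x"
  by (rule rotv_mult) simp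

lemma rotv_fixed: "J *v x = 0 \<Longrightarrow> rotv J \<alpha> x = x"
  by (simp add: rotv_def)

text \<open>The cubic relation reduces the third and fourth powers of \<open>J\<close> to
  \<open>- J\<close> and \<open>- J\<^sup>2\<close>; the addition theorems do the rest.\<close>

lemma rotv_rotv:
  assumes "\<And>x. J *v (J *v (J *v x)) = - (J *v x)"
  shows "rotv J \<alpha> (rotv J \<beta> x) = rotv J (\<alpha> + \<beta>) x"
  by (simp add: rotv_def matrix_vector_right_distrib matrix_vector_mult_scaleR assms
      sin_add cos_add algebra_simps)

text \<open>Product rule in a rotating frame. By the cubic relation, the derivative of
  \<open>rotv J \<alpha> x\<close> in \<alpha> is \<open>J *v rotv J \<alpha> x\<close>, which gives
  the extra term inside the rotation.\<close>

lemma has_vector_derivative_rotv: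
  assumes J: "\<And>x. J *v (J *v (J *v x)) = - (J *v x)"
    and z: "(z has_vector_derivative z') (at t within S)"
  shows "((\<lambda>t. rotv J (\<alpha> * t) (z t)) has_vector_derivative
            rotv J (\<alpha> * t) (z' + \<alpha> *\<^sub>R (J *v z t))) (at t within S)"
proof -
  note Jz = bounded_linear.has_vector_derivative[OF matrix_vector_mul_bounded_linear[of J]]
  show ?thesis
    unfolding rotv_def
    by (rule has_vector_derivative_eq_rhs, (rule derivative_intros z Jz | simp)+)
       (auto intro!: derivative_eq_intros simp: J matrix_vector_right_distrib
         matrix_vector_mult_scaleR algebra_simps)
qed

section \<open>Block matrices and rotations\<close>

lemma matrix_vector_mult_uminus [simp]: "A *v (- x) = - (A *v x)"
  for A :: "real ^ 'n ^ 'm"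
  by (rule linear_neg[OF matrix_vector_mul_linear])

lemma uminus_matrix_vector_mult: "(- A) *v x = - (A *v x)"
  for A :: "real ^ 'n ^ 'm"
  by (simp add: vec_eq_iff matrix_vector_mult_def sum_negf)

lemma block_stack [simp]: "block k (stack x) = x k"
  by (simp add: block_def stack_def)

lemma vec_eq_iff_block: "x = y \<longleftrightarrow> (\<forall>k. block k x = block k y)"
  by (simp add: block_def vec_eq_iff)

lemma linear_block: "linear (block k)"
  by (rule linearI) (simp_all add: block_def vec_eq_iff)

lemmas block_simps [simp] =
  linear_add[OF linear_block] linear_diff[OF linear_block] linear_neg[OF linear_block]
  linear_cmul[OF linear_block] linear_0[OF linear_block]

lemma block_block_diag_mult [simp]: "block k (block_diag A *v x) = A k *v block k x"
proof -
  have "(\<Sum>q\<in>UNIV. (if k = fst q then A (fst q) $ a $ snd q else 0) * x $ q) =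
      (\<Sum>l\<in>UNIV. \<Sum>b\<in>UNIV. if k = l then A k $ a $ b * x $ (l, b) else 0)" for a
    unfolding UNIV_Times_UNIV[symmetric] sum.cartesian_product by (rule sum.cong) auto
  also have "\<dots> a = (\<Sum>l\<in>UNIV. if k = l then \<Sum>b\<in>UNIV. A k $ a $ b * x $ (l, b) else 0)" for a
    by (rule sum.cong) auto
  finally have eq: "(\<Sum>q\<in>UNIV. (if k = fst q then A (fst q) $ a $ snd q else 0) * x $ q) =
      (\<Sum>b\<in>UNIV. A k $ a $ b * x $ (k, b))" for a by simp
  show ?thesis
    by (simp add: vec_eq_iff block_def block_diag_def matrix_vector_mult_def eq cong: if_cong)
qed

lemma block_kron_mult:
  "block k (kron A B *v x) = (\<Sum>l\<in>UNIV. A $ k $ l *\<^sub>R (B *v block l x))"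
  by (simp add: vec_eq_iff block_def kron_def matrix_vector_mult_def sum_distrib_left
      sum.cartesian_product mult.assoc case_prod_beta)

lemma block_kron_one_mult [simp]: "block k (kron (mat 1) B *v x) = B *v block k x"
proof -
  have "(\<Sum>l\<in>UNIV. (mat 1 :: real ^ _ ^ _) $ k $ l *\<^sub>R (B *v block l x)) =
      (\<Sum>l\<in>UNIV. if k = l then B *v block l x else 0)"
    by (rule sum.cong) (auto simp: mat_def)
  then show ?thesis by (simp add: block_kron_mult)
qed

lemma transpose_kron: "transpose (kron A B) = kron (transpose A) (transpose B)"
  by (simp add: vec_eq_iff kron_def transpose_def)

text \<open>The first factor only recombines blocks while the rotation acts inside each block, so
  everything reduces to the second factor. Two generators are allowed because \<open>B\<close> may
  map between the plane and the machine currents.\<close>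

lemma kron_commute:
  assumes "\<And>z. B *v (J *v z) = J' *v (B *v z)"
  shows "kron A B *v (kron (mat 1) J *v x) = kron (mat 1) J' *v (kron A B *v x)"
proof -
  have "block k (kron A B *v (kron (mat 1) J *v x)) = block k (kron (mat 1) J' *v (kron A B *v x))" for k
    unfolding block_kron_one_mult block_kron_mult[where A = A and B = B]
    by (simp add: assms linear_sum[OF matrix_vector_mul_linear] matrix_vector_mult_scaleR)
  then show ?thesis by (simp add: vec_eq_iff_block)
qed

lemma block_diag_commute:
  assumes "\<And>k z. A k *v (J *v z) = J' *v (A k *v z)"
  shows "block_diag A *v (kron (mat 1) J *v x) = kron (mat 1) J' *v (block_diag A *v x)"
  by (simp add: vec_eq_iff_block assms)

lemma block_rotv_kron [simp]: "block k (rotv (kron (mat 1) J) \<alpha> x) = rotv J \<alpha> (block k x)"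
  by (simp add: rotv_def)

lemma sum_UNIV_Plus:
  "(\<Sum>q\<in>UNIV. f q) = (\<Sum>a\<in>UNIV. f (Inl a)) + (\<Sum>b\<in>UNIV. f (Inr b))"
  for f :: "'a::finite + 'b::finite \<Rightarrow> real"
  by (simp add: sum.Plus flip: UNIV_Plus_UNIV)

lemma block_mat_mult_nth:
  "(block_mat A B C D *v z) $ Inl a = (\<Sum>j\<in>UNIV. A $ a $ j * z $ Inl j) + (\<Sum>j\<in>UNIV. B $ a $ j * z $ Inr j)"
  "(block_mat A B C D *v z) $ Inr c = (\<Sum>j\<in>UNIV. C $ c $ j * z $ Inl j) + (\<Sum>j\<in>UNIV. D $ c $ j * z $ Inr j)"
  by (simp_all add: block_mat_def matrix_vector_mult_def sum_UNIV_Plus)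

lemma vec_Plus_eq_iff:
  "x = y \<longleftrightarrow> (\<forall>a. x $ Inl a = y $ Inl a) \<and> (\<forall>b. x $ Inr b = y $ Inr b)"
  by (auto simp: vec_eq_iff split_sum_all)

section \<open>Planar rotations in coordinates\<close>

lemma jmat_nth [simp]:
  "jmat $ 1 $ 1 = 0" "jmat $ 1 $ 2 = -1" "jmat $ 2 $ 1 = 1" "jmat $ 2 $ 2 = 0"
  by (simp_all add: jmat_def rot_def vector_2)

lemma jmat_mult_nth [simp]: "(jmat *v z) $ 1 = - z $ 2" "(jmat *v z) $ 2 = z $ 1"
  by (simp_all add: matrix_vector_mult_def sum_2)

lemma Jmat_mult_nth [simp]:
  "(Jmat *v z) $ Inl 1 = - z $ Inl 2" "(Jmat *v z) $ Inl 2 = z $ Inl 1" "(Jmat *v z) $ Inr c = 0"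
  by (simp_all add: Jmat_def block_mat_mult_nth sum_2)

lemma jmat_jmat [simp]: "jmat *v (jmat *v z) = - z"
  by (simp add: vec_eq_iff forall_2)

lemma Jmat_cubed [simp]: "Jmat *v (Jmat *v (Jmat *v z)) = - (Jmat *v z)"
  by (simp add: vec_Plus_eq_iff forall_2)

lemma J2_cubed [simp]: "J2 *v (J2 *v (J2 *v z)) = - (J2 *v z)"
  by (simp add: vec_eq_iff_block J2_def)

lemma Jg_cubed [simp]: "Jg *v (Jg *v (Jg *v z)) = - (Jg *v z)"
  by (simp add: vec_eq_iff_block Jg_def)

lemma transpose_Jmat_mult: "transpose Jmat *v z = - (Jmat *v z)"
proof -
  have "transpose Jmat = - Jmat"
    by (simp add: vec_eq_iff split_sum_all transpose_def Jmat_def block_mat_def forall_2)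
  then show ?thesis
    by (simp only: uminus_matrix_vector_mult)
qed

lemma rotv_jmat_nth:
  "rotv jmat \<alpha> z $ 1 = cos \<alpha> * z $ 1 - sin \<alpha> * z $ 2"
  "rotv jmat \<alpha> z $ 2 = sin \<alpha> * z $ 1 + cos \<alpha> * z $ 2"
  by (simp_all add: rotv_def algebra_simps)

lemma rotv_Jmat_nth:
  "rotv Jmat \<alpha> z $ Inl 1 = cos \<alpha> * z $ Inl 1 - sin \<alpha> * z $ Inl 2"
  "rotv Jmat \<alpha> z $ Inl 2 = sin \<alpha> * z $ Inl 1 + cos \<alpha> * z $ Inl 2"
  "rotv Jmat \<alpha> z $ Inr c = z $ Inr c"
  by (simp_all add: rotv_def algebra_simps)

text \<open>With \<open>s\<close> and \<open>c\<close> abstract, invariance of the inner product is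
  a polynomial consequence of the Pythagorean relation.\<close>

lemma inner_rotated:
  fixes s c :: real
  assumes "s\<^sup>2 + c\<^sup>2 = 1"
  shows "(c * a - s * b) * (c * a' - s * b') + (s * a + c * b) * (s * a' + c * b') = a * a' + b * b'"
  using assms by algebra

lemma norm_rotv_jmat [simp]: "norm (rotv jmat \<alpha> z) = norm z"
  unfolding norm_eq_sqrt_inner
  by (simp add: inner_vec_def sum_2 rotv_jmat_nth inner_rotated)

lemma inner_rotv_Jmat [simp]: "rotv Jmat \<alpha> z \<bullet> rotv Jmat \<alpha> w = z \<bullet> w"
  by (simp add: inner_vec_def sum_UNIV_Plus sum_2 rotv_Jmat_nth inner_rotated)

section \<open>The inductance matrix in coordinates and its rotation law\<close>

lemma Ls_nth:
  "Ls P k \<theta> $ 1 $ 1 = ls P k + lsa P k * cos (2 * \<theta>)"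
  "Ls P k \<theta> $ 1 $ 2 = lsa P k * sin (2 * \<theta>)"
  "Ls P k \<theta> $ 2 $ 1 = lsa P k * sin (2 * \<theta>)"
  "Ls P k \<theta> $ 2 $ 2 = ls P k - lsa P k * cos (2 * \<theta>)"
  by (simp_all add: Ls_def rot_def vector_2 matrix_matrix_mult_def sum_2 mat_def)

lemma Lm_nth:
  "Lm P k \<theta> $ 1 $ 1 = lsf P k * cos \<theta>" "Lm P k \<theta> $ 2 $ 1 = lsf P k * sin \<theta>"
  "Lm P k \<theta> $ 1 $ 2 = lsd P k * cos \<theta>" "Lm P k \<theta> $ 2 $ 2 = lsd P k * sin \<theta>"
  "Lm P k \<theta> $ 1 $ 3 = lsq P k * sin \<theta>" "Lm P k \<theta> $ 2 $ 3 = - lsq P k * cos \<theta>"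
  by (simp_all add: Lm_def rot_def vector_2 vector_3 matrix_matrix_mult_def sum_2)

lemma Lk_mult_nth:
  "(Lk P k \<theta> *v z) $ Inl 1 = (ls P k + lsa P k * cos (2 * \<theta>)) * z $ Inl 1
     + lsa P k * sin (2 * \<theta>) * z $ Inl 2
     + (lsf P k * z $ Inr 1 + lsd P k * z $ Inr 2) * cos \<theta> + lsq P k * z $ Inr 3 * sin \<theta>"
  "(Lk P k \<theta> *v z) $ Inl 2 = lsa P k * sin (2 * \<theta>) * z $ Inl 1
     + (ls P k - lsa P k * cos (2 * \<theta>)) * z $ Inl 2
     + (lsf P k * z $ Inr 1 + lsd P k * z $ Inr 2) * sin \<theta> - lsq P k * z $ Inr 3 * cos \<theta>"
  "(Lk P k \<theta> *v z) $ Inr 1 = lsf P k * (cos \<theta> * z $ Inl 1 + sin \<theta> * z $ Inl 2)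
     + lf P k * z $ Inr 1 + lfd P k * z $ Inr 2"
  "(Lk P k \<theta> *v z) $ Inr 2 = lsd P k * (cos \<theta> * z $ Inl 1 + sin \<theta> * z $ Inl 2)
     + lfd P k * z $ Inr 1 + ld P k * z $ Inr 2"
  "(Lk P k \<theta> *v z) $ Inr 3 = lsq P k * (sin \<theta> * z $ Inl 1 - cos \<theta> * z $ Inl 2)
     + lq P k * z $ Inr 3"
  by (simp_all add: Lk_def block_mat_mult_nth sum_2 sum_3 Ls_nth Lm_nth transpose_def
      Lr_def vector_3 algebra_simps)

text \<open>Both sides are the cosine (respectively sine) of \<open>2 * \<theta> + \<alpha>\<close>,
  written once as \<open>2 * (\<theta> + \<alpha>) - \<alpha>\<close> and once as
  \<open>\<alpha> + 2 * \<theta>\<close>.\<close>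

lemma double_angle_rotated:
  fixes \<theta> \<alpha> :: real
  shows "cos (2 * (\<theta> + \<alpha>)) * cos \<alpha> + sin (2 * (\<theta> + \<alpha>)) * sin \<alpha>
      = cos \<alpha> * cos (2 * \<theta>) - sin \<alpha> * sin (2 * \<theta>)"
    and "sin (2 * (\<theta> + \<alpha>)) * cos \<alpha> - cos (2 * (\<theta> + \<alpha>)) * sin \<alpha>
      = sin \<alpha> * cos (2 * \<theta>) + cos \<alpha> * sin (2 * \<theta>)"
  using cos_diff[of "2 * (\<theta> + \<alpha>)" \<alpha>] sin_diff[of "2 * (\<theta> + \<alpha>)" \<alpha>]
    cos_add[of \<alpha> "2 * \<theta>"] sin_add[of \<alpha> "2 * \<theta>"] by (simp_all add: algebra_simps)

text \<open>Shifting the rotor angle conjugates \<open>Ls\<close> by the rotation, because its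
  saliency part is a multiple of a reflection turned by the double angle, and multiplies
  \<open>Lm\<close> by the rotation; \<open>Lr\<close> is constant. This is the source of the
  symmetry of the machines.\<close>

lemma Lk_shift_mult: "Lk P k (\<theta> + \<alpha>) *v rotv Jmat \<alpha> z = rotv Jmat \<alpha> (Lk P k \<theta> *v z)"
  unfolding vec_Plus_eq_iff forall_2 forall_3 rotv_Jmat_nth Lk_mult_nth
  using double_angle_rotated[of \<theta> \<alpha>] sin_cos_squared_add[of \<alpha>]
    cos_add[of \<theta> \<alpha>] sin_add[of \<theta> \<alpha>]
  by (intro conjI; algebra)

section \<open>Rotation symmetry of the power system\<close>

text \<open>The matrix [I, 0] selecting the stator currents, in exactly the form it has inside
  \<open>Iv\<close>, so that unfolding \<open>Iv_def\<close> produces it.\<close>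

abbreviation stator_proj :: "real ^ (2 + 3) ^ 2" where
  "stator_proj \<equiv> \<chi> a q. case q of Inl b \<Rightarrow> mat 1 $ a $ b | Inr _ \<Rightarrow> 0"

lemma stator_proj_mult_nth: "(stator_proj *v z) $ a = z $ Inl a"
  by (simp add: matrix_vector_mult_def sum_UNIV_Plus mat_def if_distrib[of "\<lambda>x. x * _"] cong: if_cong)

lemma transpose_stator_proj_mult_nth:
  "(transpose stator_proj *v z) $ Inl a = z $ a" "(transpose stator_proj *v z) $ Inr b = 0"
  by (simp_all del: transpose_matrix_vector
      add: matrix_vector_mult_def transpose_def mat_def if_distrib[of "\<lambda>x. x * _"] cong: if_cong)

lemma stator_proj_commute: "stator_proj *v (Jmat *v z) = jmat *v (stator_proj *v z)"
  by (simp add: vec_eq_iff forall_2 stator_proj_mult_nth)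

lemma transpose_stator_proj_commute:
  "transpose stator_proj *v (jmat *v z) = Jmat *v (transpose stator_proj *v z)"
  by (simp del: transpose_matrix_vector
      add: vec_Plus_eq_iff forall_2 transpose_stator_proj_mult_nth)

lemma block_transpose_Iv_mult:
  fixes P :: "('g::finite, 'v::finite, 't::finite) power_system"
  shows "block k (transpose (Iv P) *v w) = transpose stator_proj *v block (gen_bus P k) w"
proof -
  have "(\<Sum>l\<in>UNIV. transpose (attach P) $ k $ l *\<^sub>R (transpose stator_proj *v block l w)) =
      (\<Sum>l\<in>UNIV. if l = gen_bus P k then transpose stator_proj *v block l w else 0)"
    by (rule sum.cong) (auto simp: attach_def transpose_def)
  then show ?thesis
    unfolding Iv_def transpose_kron block_kron_mult by simp
qed

lemma block_Isel_f_mult: "block k (Isel_f *v w) = w $ k *\<^sub>R axis (Inr 1) 1"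
  by (simp add: vec_eq_iff block_def Isel_f_def kron_col_def matrix_vector_mult_def mat_def
      if_distrib[of "\<lambda>x. x * _"] cong: if_cong)

lemma Emat_J2: "Emat P *v (J2 *v x) = J2 *v (Emat P *v x)"
  unfolding Emat_def J2_def by (rule kron_commute) simp

lemma transpose_Emat_J2: "transpose (Emat P) *v (J2 *v x) = J2 *v (transpose (Emat P) *v x)"
  unfolding Emat_def J2_def transpose_kron by (rule kron_commute) simp

lemma Iv_Jg: "Iv P *v (Jg *v x) = J2 *v (Iv P *v x)"
  unfolding Iv_def J2_def Jg_def by (rule kron_commute) (rule stator_proj_commute)

lemma transpose_Iv_J2: "transpose (Iv P) *v (J2 *v x) = Jg *v (transpose (Iv P) *v x)"
  unfolding Iv_def J2_def Jg_def transpose_kron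
  by (rule kron_commute) (rule transpose_stator_proj_commute)

text \<open>The excitation acts on a rotor winding, which the rotation fixes; a constant input
  therefore stays constant in the rotating frame.\<close>

lemma Jg_Isel_f: "Jg *v (Isel_f *v w) = 0"
  by (simp add: vec_eq_iff_block Jg_def block_Isel_f_mult vec_Plus_eq_iff forall_2
      matrix_vector_mult_scaleR axis_def)

lemma scaleR_mat_mult: "(c *\<^sub>R mat 1) *v x = c *\<^sub>R x" for x :: "real ^ 'n"
  by (simp flip: scaleR_matrix_vector_assoc)

lemma Cmat_J2: "Cmat P *v (J2 *v x) = J2 *v (Cmat P *v x)"
  unfolding Cmat_def J2_def by (rule block_diag_commute) (simp add: scaleR_mat_mult matrix_vector_mult_scaleR)

lemma LTmat_J2: "LTmat P *v (J2 *v x) = J2 *v (LTmat P *v x)"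
  unfolding LTmat_def J2_def by (rule block_diag_commute) (simp add: scaleR_mat_mult matrix_vector_mult_scaleR)

lemma RTmat_J2: "RTmat P *v (J2 *v x) = J2 *v (RTmat P *v x)"
  unfolding RTmat_def J2_def by (rule block_diag_commute) (simp add: scaleR_mat_mult matrix_vector_mult_scaleR)

lemma Rk_mult_nth:
  "(Rk P k *v z) $ Inl a = rs P k * z $ Inl a"
  "(Rk P k *v z) $ Inr 1 = rf P k * z $ Inr 1"
  "(Rk P k *v z) $ Inr 2 = rd P k * z $ Inr 2"
  "(Rk P k *v z) $ Inr 3 = rq P k * z $ Inr 3"
  by (simp_all add: Rk_def block_mat_mult_nth sum_3 vector_3 mat_def if_distrib[of "\<lambda>x. x * _"]
      if_distrib[of "\<lambda>x. _ * x"] cong: if_cong)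

lemma Rmat_Jg: "Rmat P *v (Jg *v x) = Jg *v (Rmat P *v x)"
  unfolding Rmat_def Jg_def
  by (rule block_diag_commute)
     (simp add: vec_Plus_eq_iff forall_2 forall_3 Rk_mult_nth)

lemma Lmat_shift_mult:
  "Lmat P (\<theta> + (\<chi> k. \<alpha>)) *v rotv Jg \<alpha> x = rotv Jg \<alpha> (Lmat P \<theta> *v x)"
  by (simp add: vec_eq_iff_block Lmat_def Jg_def Lk_shift_mult)

text \<open>Meant for \<open>L\<close> and \<open>L'\<close> the inductance matrices at the original
  and the shifted angle, and for \<open>K\<close> and \<open>K'\<close> the generator or its
  transpose.\<close>

lemma rotv_mult_products:
  fixes J :: "real ^ 'n ^ 'n"
  assumes "\<And>z. L' *v rotv J \<alpha> z = rotv J \<alpha> (L *v z)"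
    and "\<And>z. K *v (J *v z) = J *v (K *v z)" and "\<And>z. K' *v (J *v z) = J *v (K' *v z)"
  shows "(L' ** K + K' ** L') *v rotv J \<alpha> z = rotv J \<alpha> ((L ** K + K' ** L) *v z)"
  by (simp add: matrix_vector_mult_add_rdistrib linear_add[OF linear_rotv] assms(1)
      flip: matrix_vector_mul_assoc rotv_mult[OF assms(2)] rotv_mult[OF assms(3)])

text \<open>The torque is half an inner product of two vectors that are rotated alike.\<close>

lemma torque_shift: "torque P (\<theta> + (\<chi> k. \<alpha>)) (rotv Jg \<alpha> i) = torque P \<theta> i"
proof -
  have "(Lk P k (\<theta> $ k + \<alpha>) ** Jmat + transpose Jmat ** Lk P k (\<theta> $ k + \<alpha>)) *v rotv Jmat \<alpha> z =
      rotv Jmat \<alpha> ((Lk P k (\<theta> $ k) ** Jmat + transpose Jmat ** Lk P k (\<theta> $ k)) *v z)" for k z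
    by (rule rotv_mult_products) (simp_all del: transpose_matrix_vector add: Lk_shift_mult transpose_Jmat_mult)
  then show ?thesis by (simp add: torque_def Jg_def)
qed

lemma v_ind_shift: "v_ind P (\<theta> + (\<chi> k. \<alpha>)) \<omega> (rotv Jg \<alpha> i) = rotv Jg \<alpha> (v_ind P \<theta> \<omega> i)"
proof -
  have "(Lk P k (\<theta> $ k + \<alpha>) ** transpose Jmat + Jmat ** Lk P k (\<theta> $ k + \<alpha>)) *v rotv Jmat \<alpha> z =
      rotv Jmat \<alpha> ((Lk P k (\<theta> $ k) ** transpose Jmat + Jmat ** Lk P k (\<theta> $ k)) *v z)" for k z
    by (rule rotv_mult_products) (simp_all del: transpose_matrix_vector add: Lk_shift_mult transpose_Jmat_mult)
  then show ?thesis
    by (simp add: vec_eq_iff_block v_ind_def Jg_def linear_cmul[OF linear_rotv])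
qed

lemma load_admittance_mult: "load_admittance g b r *v z = g r *\<^sub>R z + b r *\<^sub>R (jmat *v z)"
  by (simp add: load_admittance_def matrix_vector_mult_add_rdistrib flip: scaleR_matrix_vector_assoc)

text \<open>The admittance depends only on the norm of the voltage, which rotations preserve, and it
  is a combination of the identity and \<open>jmat\<close>, which commute with rotations.\<close>

lemma load_current_rotv:
  assumes "wf_power_system P"
  shows "load_current P (rotv J2 \<alpha> v) = rotv J2 \<alpha> (load_current P v)"
proof -
  have "iload P k (rotv jmat \<alpha> w) = rotv jmat \<alpha> (iload P k w)" for k w
  proof -
    have il: "iload P k w = load_admittance (gload P k) (bload P k) (norm w) *v w" for w
      using assms by (auto simp: wf_power_system_def admittance_load_def)
    have "rotv jmat \<alpha> (load_admittance (gload P k) (bload P k) (norm w) *v w) =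
        load_admittance (gload P k) (bload P k) (norm w) *v rotv jmat \<alpha> w"
      by (rule rotv_mult) (simp add: load_admittance_mult matrix_vector_right_distrib matrix_vector_mult_scaleR)
    then show ?thesis by (simp add: il[of w] il[of "rotv jmat \<alpha> w"])
  qed
  then show ?thesis by (simp add: vec_eq_iff_block load_current_def J2_def)
qed

section \<open>Invertibility of the mass and impedance matrices\<close>

lemma invertible_diag_mat: "(\<And>k. d k \<noteq> 0) \<Longrightarrow> invertible (diag_mat d)"
  by (simp add: invertible_iff_ker diag_mat_def matrix_vector_mult_def vec_eq_iff
      if_distrib[of "\<lambda>x. x * _"] cong: if_cong)

lemma invertible_block_diag:
  fixes A :: "'k::finite \<Rightarrow> real ^ 'n ^ 'n"
  assumes "\<And>k. invertible (A k)"
  shows "invertible (block_diag A)"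
  using assms by (simp add: invertible_iff_ker vec_eq_iff_block[of _ 0]) blast

lemma invertible_scaleR_mat: "c \<noteq> 0 \<Longrightarrow> invertible (c *\<^sub>R mat 1 :: real ^ 'n ^ 'n)"
  by (simp add: invertible_iff_ker scaleR_mat_mult)

context
  fixes P :: "('g::finite, 'v::finite, 't::finite) power_system"
  assumes wf: "wf_power_system P"
begin

lemma invertible_Mmat: "invertible (Mmat P)"
  and invertible_Lmat: "invertible (Lmat P \<theta>)"
  and invertible_Cmat: "invertible (Cmat P)"
  and invertible_LTmat: "invertible (LTmat P)"
  using wf unfolding wf_power_system_def Mmat_def Lmat_def Cmat_def LTmat_def
  by (auto intro!: invertible_diag_mat invertible_block_diag invertible_scaleR_mat
      simp: less_imp_neq[THEN not_sym])

text \<open>In the inner product of a block with its image the skew-symmetric reactance drops out,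
  and the positive resistance forces the block to vanish.\<close>

lemma invertible_ZT: "invertible (ZT P \<omega>0)"
  unfolding invertible_iff_ker
proof (intro allI impI)
  fix x assume x: "ZT P \<omega>0 *v x = 0"
  have "block l x = 0" for l
  proof -
    have "block l (ZT P \<omega>0 *v x) = rT P l *\<^sub>R block l x + (\<omega>0 * lT P l) *\<^sub>R (jmat *v block l x)"
      by (simp add: ZT_def RTmat_def LTmat_def J2_def matrix_vector_mult_add_rdistrib scaleR_mat_mult
          matrix_vector_mult_scaleR flip: scaleR_matrix_vector_assoc matrix_vector_mul_assoc)
    then have "(rT P l *\<^sub>R block l x + (\<omega>0 * lT P l) *\<^sub>R (jmat *v block l x)) \<bullet> block l x = 0"
      using x by simp
    then have "rT P l * (block l x \<bullet> block l x) = 0"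
      by (simp add: inner_vec_def sum_2 algebra_simps)
    then show ?thesis using wf by (auto simp: wf_power_system_def less_imp_neq[THEN not_sym])
  qed
  then show "x = 0" by (simp add: vec_eq_iff_block[of x])
qed

text \<open>Clears the inverses: later comparisons of velocities become equations free of
  \<open>matrix_inv\<close>.\<close>

lemma vector_field_eq_iff:
  "vector_field P (\<theta>, \<omega>, i, v, iT) (\<tau>m, vf) = (a, b, c, d, e) \<longleftrightarrow>
     a = \<omega> \<and>
     Mmat P *v b = - (Dmat P *v \<omega>) - torque P \<theta> i + \<tau>m \<and>
     Lmat P \<theta> *v c = - (Rmat P *v i) + transpose (Iv P) *v v + Isel_f *v vf - v_ind P \<theta> \<omega> i \<and>
     Cmat P *v d = - (Iv P *v i) - Emat P *v iT - load_current P v \<and>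
     LTmat P *v e = - (RTmat P *v iT) + transpose (Emat P) *v v"
  unfolding vector_field_def prod.case prod.inject
    matrix_inv_mult_eq_iff[OF invertible_Mmat] matrix_inv_mult_eq_iff[OF invertible_Lmat]
    matrix_inv_mult_eq_iff[OF invertible_Cmat] matrix_inv_mult_eq_iff[OF invertible_LTmat]
  by (auto simp del: transpose_matrix_vector)

end


text \<open>The linear part of the affine map \<open>rot_state\<close> below; it acts on velocities,
  so the angle shift is absent.\<close>

definition rot_lin :: "real \<Rightarrow> ('g::finite, 'v::finite, 't::finite) state \<Rightarrow> ('g, 'v, 't) state" where
  "rot_lin \<alpha> = (\<lambda>(\<theta>, \<omega>, i, v, iT). (\<theta>, \<omega>, rotv Jg \<alpha> i, rotv J2 \<alpha> v, rotv J2 \<alpha> iT))"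

definition rot_state :: "real \<Rightarrow> ('g::finite, 'v::finite, 't::finite) state \<Rightarrow> ('g, 'v, 't) state" where
  "rot_state \<alpha> = (\<lambda>(\<theta>, \<omega>, i, v, iT).
     (\<theta> + (\<chi> k. \<alpha>), \<omega>, rotv Jg \<alpha> i, rotv J2 \<alpha> v, rotv J2 \<alpha> iT))"

section \<open>The rotating frame\<close>

lemma rot_state_zero [simp]: "rot_state 0 x = x"
  by (auto simp: rot_state_def vec_eq_iff split: prod.split)

lemma rot_state_add: "rot_state \<alpha> (rot_state \<beta> x) = rot_state (\<alpha> + \<beta>) x"
  by (auto simp: rot_state_def rotv_rotv vec_eq_iff split: prod.split)

lemma linear_rot_lin: "linear (rot_lin \<alpha>)"
  by (rule linearI)
     (auto simp: rot_lin_def linear_add[OF linear_rotv] linear_cmul[OF linear_rotv] split: prod.split)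

lemma rot_lin_inverse: "rot_lin (- \<alpha>) (rot_lin \<alpha> x) = x"
  by (auto simp: rot_lin_def rotv_rotv split: prod.split)

lemma rot_lin_eq_iff [simp]: "rot_lin \<alpha> x = rot_lin \<alpha> y \<longleftrightarrow> x = y"
  by (metis rot_lin_inverse)

lemma sync_field_uminus: "sync_field (- \<alpha>) x = - sync_field \<alpha> x"
  by (auto simp: sync_field_def vec_eq_iff split: prod.split)

text \<open>The synchronous field generates the one-parameter group of the maps
  \<open>rot_state\<close> and is therefore equivariant under it.\<close>

lemma sync_field_rot_state: "sync_field \<omega>0 (rot_state \<alpha> x) = rot_lin \<alpha> (sync_field \<omega>0 x)"
  by (auto simp: rot_state_def rot_lin_def sync_field_def rotv_generator linear_cmul[OF linear_rotv]
      split: prod.split)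

text \<open>The frame change, used in two ways: with rate \<open>- \<omega>0\<close> it turns a
  trajectory into a motion driven by the difference of the two fields, and with a constant
  \<open>x\<close> it shows that rotating a state follows the synchronous field.\<close>

lemma has_vector_derivative_rot_state:
  assumes "(x has_vector_derivative x') (at t within S)"
  shows "((\<lambda>t. rot_state (\<alpha> * t) (x t)) has_vector_derivative
            rot_lin (\<alpha> * t) (x' + sync_field \<alpha> (x t))) (at t within S)"
proof -
  note f = bounded_linear.has_vector_derivative[OF bounded_linear_fst]
  note s = bounded_linear.has_vector_derivative[OF bounded_linear_snd]
  have shift: "((\<lambda>t. \<chi> k. \<alpha> * t) has_vector_derivative (\<chi> k. \<alpha>)) (at t within S)"
  proof -
    have "((\<lambda>t. (\<alpha> * t) *\<^sub>R (\<chi> k. (1 :: real))) has_vector_derivative \<alpha> *\<^sub>R (\<chi> k. (1 :: real))) (at t within S)"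
      by (auto intro!: derivative_eq_intros)
    then show ?thesis by (simp add: scaleR_vec_def)
  qed
  have "((\<lambda>t. (fst (x t) + (\<chi> k. \<alpha> * t), fst (snd (x t)), rotv Jg (\<alpha> * t) (fst (snd (snd (x t)))),
        rotv J2 (\<alpha> * t) (fst (snd (snd (snd (x t))))), rotv J2 (\<alpha> * t) (snd (snd (snd (snd (x t)))))))
      has_vector_derivative
        (fst x' + (\<chi> k. \<alpha>), fst (snd x'),
         rotv Jg (\<alpha> * t) (fst (snd (snd x')) + \<alpha> *\<^sub>R (Jg *v fst (snd (snd (x t))))),
         rotv J2 (\<alpha> * t) (fst (snd (snd (snd x'))) + \<alpha> *\<^sub>R (J2 *v fst (snd (snd (snd (x t)))))),
         rotv J2 (\<alpha> * t) (snd (snd (snd (snd x'))) + \<alpha> *\<^sub>R (J2 *v snd (snd (snd (snd (x t))))))))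
      (at t within S)"
    by (intro has_vector_derivative_Pair has_vector_derivative_rotv has_vector_derivative_add
        f s shift assms J2_cubed Jg_cubed)
  then show ?thesis
    by (simp add: rot_state_def rot_lin_def sync_field_def case_prod_beta)
qed

text \<open>After the mass matrices are cleared, every electrical term is carried along by the
  rotation, while the speeds and the torque are unchanged.\<close>

lemma vector_field_rot_state:
  assumes "wf_power_system P"
  shows "vector_field P (rot_state \<alpha> x) u = rot_lin \<alpha> (vector_field P x u)"
proof -
  obtain \<theta> \<omega> i v iT where x: "x = (\<theta>, \<omega>, i, v, iT)" by (metis prod.exhaust)
  obtain \<tau>m vf where u: "u = (\<tau>m, vf)" by fastforce
  obtain a b c d e where f: "vector_field P x u = (a, b, c, d, e)" by (metis prod.exhaust)
  note eqs = f[unfolded x u vector_field_eq_iff[OF assms]]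
  show ?thesis
    unfolding f unfolding x u rot_state_def rot_lin_def prod.case vector_field_eq_iff[OF assms]
    using eqs
    by (simp del: transpose_matrix_vector add: Lmat_shift_mult torque_shift v_ind_shift
        load_current_rotv[OF assms] linear_add[OF linear_rotv] linear_diff[OF linear_rotv]
        linear_neg[OF linear_rotv] rotv_fixed[OF Jg_Isel_f]
        rotv_mult[OF RTmat_J2] rotv_mult[OF Rmat_Jg] rotv_mult[OF Emat_J2]
        rotv_mult[OF transpose_Emat_J2] rotv_mult[OF Iv_Jg] rotv_mult[OF transpose_Iv_J2]
        flip: rotv_mult[OF Cmat_J2] rotv_mult[OF LTmat_J2])
qed

text \<open>Makes the input recoverable from the velocity: the mechanical torque enters additively
  in the speed equation, the excitation in the field winding row.\<close>

lemma vector_field_input_inj: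
  assumes wf: "wf_power_system P" and eq: "vector_field P x u = vector_field P x u'"
  shows "u = u'"
proof -
  obtain \<theta> \<omega> i v iT where x: "x = (\<theta>, \<omega>, i, v, iT)" by (metis prod.exhaust)
  obtain \<tau>m vf where u: "u = (\<tau>m, vf)" by fastforce
  obtain \<tau>m' vf' where u': "u' = (\<tau>m', vf')" by fastforce
  obtain a b c d e where f: "vector_field P x u = (a, b, c, d, e)" by (metis prod.exhaust)
  have f': "vector_field P x u' = (a, b, c, d, e)" using f eq by simp
  have "\<tau>m = \<tau>m'" and I: "Isel_f *v vf = Isel_f *v vf'"
    using f f' unfolding x u u' vector_field_eq_iff[OF wf]
    by (auto simp del: transpose_matrix_vector simp: algebra_simps)
  have "vf $ k = vf' $ k" for k
    using arg_cong[OF I, of "\<lambda>z. block k z $ Inr 1"] by (simp add: block_Isel_f_mult)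
  with \<open>\<tau>m = \<tau>m'\<close> show ?thesis by (simp add: u u' vec_eq_iff)
qed

section \<open>Differentiability of the vector field\<close>

lemma differentiable_bounded_linear:
  assumes "bounded_linear L" and "f differentiable (at x within S)"
  shows "(\<lambda>x. L (f x)) differentiable (at x within S)"
proof -
  obtain f' where "(f has_derivative f') (at x within S)"
    using assms(2) by (auto simp: differentiable_def)
  then show ?thesis by (rule differentiableI[OF bounded_linear.has_derivative[OF assms(1)]])
qed

lemma differentiable_at_compose:
  assumes "f differentiable (at x within S)" and "g differentiable (at (f x))"
  shows "(\<lambda>x. g (f x)) differentiable (at x within S)"
  using differentiable_chain_within[OF assms(1) differentiable_at_withinI[OF assms(2)]]
  by (simp add: o_def)

lemma differentiable_matrix_vector_mult:
  fixes A :: "'a::real_normed_vector \<Rightarrow> real ^ 'n ^ 'm"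
  assumes "\<And>i j. (\<lambda>x. A x $ i $ j) differentiable (at x within S)"
    and "\<And>i. (\<lambda>x. b x $ i) differentiable (at x within S)"
  shows "(\<lambda>x. (A x *v b x) $ i) differentiable (at x within S)"
  unfolding matrix_vector_mult_def using assms by simp

lemma differentiable_matrix_mult:
  fixes A :: "'a::real_normed_vector \<Rightarrow> real ^ 'n ^ 'm"
  assumes "\<And>i j. (\<lambda>x. A x $ i $ j) differentiable (at x within S)"
    and "\<And>i j. (\<lambda>x. B x $ i $ j) differentiable (at x within S)"
  shows "(\<lambda>x. (A x ** B x) $ i $ j) differentiable (at x within S)"
  unfolding matrix_matrix_mult_def using assms by simp

lemma differentiable_sin_cos:
  "(\<lambda>\<theta>. sin (c * \<theta> :: real)) differentiable (at x within S)"
  "(\<lambda>\<theta>. cos (c * \<theta> :: real)) differentiable (at x within S)"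
  by (auto simp: differentiable_def intro!: exI derivative_eq_intros)

lemma differentiable_Lk: "(\<lambda>\<theta>. Lk P k \<theta> $ a $ b) differentiable (at \<theta> within S)"
proof -
  note trig = differentiable_sin_cos differentiable_sin_cos[of 1, unfolded mult_1]
  have "(\<lambda>\<theta>. Ls P k \<theta> $ p $ q) differentiable (at \<theta> within S)" for p q
    using trig exhaust_2[of p] exhaust_2[of q] by (elim disjE) (simp_all add: Ls_nth)
  moreover have "(\<lambda>\<theta>. Lm P k \<theta> $ p $ q) differentiable (at \<theta> within S)" for p q
    using trig exhaust_2[of p] exhaust_3[of q] by (elim disjE) (simp_all add: Lm_nth)
  ultimately show ?thesis
    by (cases a; cases b) (simp_all add: Lk_def block_mat_def transpose_def)
qed

text \<open>Supplies the hypothesis of \<open>stationary_unique\<close> for the field seen in the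
  rotating frame. The inverse inductance matrix is handled by Cramer's rule, the loads by
  assumption.\<close>

lemma differentiable_rel_field:
  assumes wf: "wf_power_system P"
  shows "(\<lambda>x. vector_field P x u - sync_field \<omega>0 x) differentiable (at x0)"
proof -
  obtain \<tau>m vf where u: "u = (\<tau>m, vf)" by fastforce
  let ?D = "\<lambda>f. f differentiable (at x0)"
  note bl = differentiable_bounded_linear
  note mv = bl[OF matrix_vector_mul_bounded_linear]
  have dvec: "?D (\<lambda>x. g x $ k)" if "?D g" for g :: "_ \<Rightarrow> real ^ 'q" and k
    using that by (rule bl[OF bounded_linear_vec_nth])
  have th: "?D (\<lambda>x. fst x)" and om: "?D (\<lambda>x. fst (snd x))" and i: "?D (\<lambda>x. fst (snd (snd x)))"
    and v: "?D (\<lambda>x. fst (snd (snd (snd x))))" and iT: "?D (\<lambda>x. snd (snd (snd (snd x))))"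
    by (intro bl[OF bounded_linear_fst] bl[OF bounded_linear_snd] differentiable_ident)+
  have bi: "?D (\<lambda>x. block k (fst (snd (snd x))))" and bv: "?D (\<lambda>x. block l (fst (snd (snd (snd x)))))" for k l
    by (intro bl[of "block _"] i v linear_block[unfolded linear_conv_bounded_linear])+
  have L: "?D (\<lambda>x. Lk P k (fst x $ k) $ a $ b)" for k a b
    by (rule differentiable_at_compose[OF dvec[OF th] differentiable_Lk])
  have LK: "?D (\<lambda>x. ((Lk P k (fst x $ k) ** K + K' ** Lk P k (fst x $ k)) *v block k (fst (snd (snd x)))) $ a)"
    for k K K' a
    by (rule differentiable_matrix_vector_mult)
       (simp_all add: differentiable_matrix_mult L dvec[OF bi])
  have t: "?D (\<lambda>x. torque P (fst x) (fst (snd (snd x))))"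
    unfolding torque_def differentiable_vec_iff
    by (simp add: inner_vec_def LK dvec[OF bi])
  have vi: "?D (\<lambda>x. v_ind P (fst x) (fst (snd x)) (fst (snd (snd x))))"
    unfolding v_ind_def differentiable_vec_iff stack_def by (simp add: LK dvec[OF om])
  have lc: "?D (\<lambda>x. load_current P (fst (snd (snd (snd x)))))"
    unfolding load_current_def differentiable_vec_iff stack_def vec_lambda_beta
    using wf by (intro allI dvec differentiable_at_compose[OF bv]) (auto simp: wf_power_system_def)
  have Lm: "?D (\<lambda>x. Lmat P (fst x) $ p $ q)" for p q
    by (cases "fst p = fst q") (simp_all add: Lmat_def block_diag_def L)
  \<comment> \<open>Both fields with tuple patterns replaced by projections, so that the rules for
    composition apply.\<close>
  have "?D (\<lambda>x. (fst (snd x),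
      matrix_inv (Mmat P) *v (- (Dmat P *v fst (snd x)) - torque P (fst x) (fst (snd (snd x))) + \<tau>m),
      matrix_inv (Lmat P (fst x)) *v
        (- (Rmat P *v fst (snd (snd x))) + transpose (Iv P) *v fst (snd (snd (snd x)))
          + Isel_f *v vf - v_ind P (fst x) (fst (snd x)) (fst (snd (snd x)))),
      matrix_inv (Cmat P) *v (- (Iv P *v fst (snd (snd x))) - Emat P *v snd (snd (snd (snd x)))
          - load_current P (fst (snd (snd (snd x))))),
      matrix_inv (LTmat P) *v (- (RTmat P *v snd (snd (snd (snd x))))
          + transpose (Emat P) *v fst (snd (snd (snd x)))))
    - ((\<chi> k. \<omega>0), 0, \<omega>0 *\<^sub>R (Jg *v fst (snd (snd x))), \<omega>0 *\<^sub>R (J2 *v fst (snd (snd (snd x)))),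
        \<omega>0 *\<^sub>R (J2 *v snd (snd (snd (snd x))))))"
    by (intro differentiable_Pair differentiable_diff differentiable_add differentiable_minus
        differentiable_matrix_inv_mult Lm dvec invertible_Lmat[OF wf] differentiable_scaleR mv
        th om i v iT t vi lc differentiable_const)
  then show ?thesis
    by (simp add: vector_field_def sync_field_def case_prod_beta u del: transpose_matrix_vector)
qed

section \<open>Steady state operation\<close>

text \<open>Reduces a statement about all times to one at time 0: a steady motion is the rotation of
  its initial state, and equivariance transports the agreement of the two fields along it.\<close>

lemma operates_in_steady_state_iff:
  assumes wf: "wf_power_system P"
  shows "operates_in_steady_state P \<omega>0 u x0 \<longleftrightarrow>
     vector_field P x0 (u 0) = sync_field \<omega>0 x0 \<and> (\<forall>t\<ge>0. u t = u 0)"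
proof
  \<comment> \<open>Seen from the rotating frame, a trajectory moves with the rotated difference of
    the two fields.\<close>
  have rel: "((\<lambda>t. rot_state (- \<omega>0 * t) (x t)) has_vector_derivative
      rot_lin (- \<omega>0 * t) (vector_field P (x t) (u t) - sync_field \<omega>0 (x t))) (at t within {0..})"
    if "trajectory P u x0 x" "t \<ge> 0" for x t
    using that has_vector_derivative_rot_state[of x _ t "{0..}" "- \<omega>0"]
    by (simp add: trajectory_def sync_field_uminus)
  {
    assume "operates_in_steady_state P \<omega>0 u x0"
    then obtain x where x: "trajectory P u x0 x"
      and st: "\<And>t. t \<ge> 0 \<Longrightarrow> vector_field P (x t) (u t) = sync_field \<omega>0 (x t)"
      unfolding operates_in_steady_state_def by blast
    \<comment> \<open>The input is taken at time \<open>t\<close> but the state at time 0; comparing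
      with the input at time 0 then shows that the input is constant.\<close>
    have st0: "vector_field P x0 (u t) = sync_field \<omega>0 x0" if "t \<ge> 0" for t
    proof -
      have "rot_state (- \<omega>0 * t) (x t) = rot_state (- \<omega>0 * 0) (x 0)"
        by (rule has_derivative_zero_unique[where s = "{0..}" and f = "\<lambda>t. rot_state (- \<omega>0 * t) (x t)"])
           (use that rel[OF x] st in
             \<open>auto simp: has_vector_derivative_def linear_0[OF linear_rot_lin]\<close>)
      then have "rot_state (\<omega>0 * t) (rot_state (- \<omega>0 * t) (x t)) = rot_state (\<omega>0 * t) x0"
        using x by (simp add: trajectory_def)
      then have "x t = rot_state (\<omega>0 * t) x0" by (simp add: rot_state_add)
      then show ?thesis
        using st[OF that] by (simp add: vector_field_rot_state[OF wf] sync_field_rot_state)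
    qed
    have "u t = u 0" if "t \<ge> 0" for t
      using vector_field_input_inj[OF wf, of x0 "u t" "u 0"] st0[OF that] st0[of 0] by simp
    then show "vector_field P x0 (u 0) = sync_field \<omega>0 x0 \<and> (\<forall>t\<ge>0. u t = u 0)"
      using st0[of 0] by blast
  }
  assume "vector_field P x0 (u 0) = sync_field \<omega>0 x0 \<and> (\<forall>t\<ge>0. u t = u 0)"
  then have eq: "vector_field P x0 (u 0) = sync_field \<omega>0 x0"
    and const: "\<And>t. t \<ge> 0 \<Longrightarrow> u t = u 0" by blast+
  \<comment> \<open>Existence: rotating \<open>x0\<close> at rate \<open>\<omega>0\<close> solves
    the equation.\<close>
  have "trajectory P u x0 (\<lambda>t. rot_state (\<omega>0 * t) x0)"
    unfolding trajectory_def
  proof (intro conjI allI impI)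
    fix t :: real assume t: "t \<ge> 0"
    show "((\<lambda>t. rot_state (\<omega>0 * t) x0) has_vector_derivative
        vector_field P (rot_state (\<omega>0 * t) x0) (u t)) (at t within {0..})"
      using has_vector_derivative_rot_state[OF has_vector_derivative_const[of x0], of \<omega>0 t "{0..}"]
        eq const[OF t]
      by (simp add: vector_field_rot_state[OF wf])
  qed simp
  moreover have "vector_field P (x t) (u t) = sync_field \<omega>0 (x t)"
    if x: "trajectory P u x0 x" and t: "t \<ge> 0" for x t
  proof -
    \<comment> \<open>With the input frozen at \<open>u 0\<close>, equivariance makes the equation
      in the rotating frame autonomous, with \<open>x0\<close> as an equilibrium.\<close>
    have "rot_state (- \<omega>0 * t) (x t) = x0"
    proof (rule stationary_unique[OF differentiable_rel_field[OF wf, of "u 0" \<omega>0]])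
      show "vector_field P x0 (u 0) - sync_field \<omega>0 x0 = 0" using eq by simp
      show "rot_state (- \<omega>0 * 0) (x 0) = x0" using x by (simp add: trajectory_def)
      show "((\<lambda>t. rot_state (- \<omega>0 * t) (x t)) has_vector_derivative
          vector_field P (rot_state (- \<omega>0 * t) (x t)) (u 0)
            - sync_field \<omega>0 (rot_state (- \<omega>0 * t) (x t))) (at t within {0..})"
        if "t \<ge> 0" for t
        using rel[OF x that] const[OF that]
        by (simp add: vector_field_rot_state[OF wf] sync_field_rot_state linear_diff[OF linear_rot_lin])
    qed (rule t)
    then have "rot_lin (- \<omega>0 * t) (vector_field P (x t) (u t)) = rot_lin (- \<omega>0 * t) (sync_field \<omega>0 (x t))"
      using eq const[OF t] vector_field_rot_state[OF wf, of "- \<omega>0 * t" "x t" "u t"]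
        sync_field_rot_state[of \<omega>0 "- \<omega>0 * t" "x t"] by simp
    then show ?thesis by (simp only: rot_lin_eq_iff)
  qed
  ultimately show "operates_in_steady_state P \<omega>0 u x0"
    unfolding operates_in_steady_state_def by blast
qed

text \<open>The two polarization conditions together say that \<open>n\<close> has signed length
  \<open>c\<close> along the unit vector \<open>e\<close>. The sign \<sigma> is that of
  \<open>c\<close>; for \<open>c = 0\<close> the vector \<open>n\<close> vanishes and either sign
  serves.\<close>

lemma signed_norm_iff:
  fixes n e :: "'a::real_normed_vector"
  assumes e: "norm e = 1"
  shows "(\<exists>\<sigma>\<in>{- 1, 1}. c = \<sigma> * norm n \<and> norm n *\<^sub>R e = \<sigma> *\<^sub>R n) \<longleftrightarrow> n = c *\<^sub>R e"
proof
  show "n = c *\<^sub>R e" if "\<exists>\<sigma>\<in>{- 1, 1}. c = \<sigma> * norm n \<and> norm n *\<^sub>R e = \<sigma> *\<^sub>R n"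
    using that by (auto simp flip: scaleR_scaleR)
  assume n: "n = c *\<^sub>R e"
  show "\<exists>\<sigma>\<in>{- 1, 1}. c = \<sigma> * norm n \<and> norm n *\<^sub>R e = \<sigma> *\<^sub>R n"
    by (rule bexI[of _ "if c < 0 then - 1 else 1"]) (auto simp: n e)
qed

section \<open>Network and machine equations at the initial state\<close>

lemma norm_jmat_rvec: "norm (jmat *v rvec \<theta>) = 1"
  by (simp add: norm_eq_sqrt_inner inner_vec_def sum_2 rvec_def vector_2 flip: power2_eq_square)

text \<open>The nodal balance is the bus equation with the line currents eliminated, and the line
  equation is the definition of \<open>iT\<close> through \<open>ZT\<close>. Hence the bus and line
  components of the steady state identity hold by hypothesis, and only machine equations
  remain.\<close>

lemma network_balance:
  fixes P :: "('g::finite, 'v::finite, 't::finite) power_system"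
  assumes wf: "wf_power_system P"
    and bal: "(i_s, v) \<in> nodal_balance P \<omega>0"
    and iT: "iT = matrix_inv (ZT P \<omega>0) *v (transpose (Emat P) *v v)"
    and i_s: "stator_currents i = i_s"
  shows "Cmat P *v (\<omega>0 *\<^sub>R (J2 *v v)) = - (Iv P *v i) - Emat P *v iT - load_current P v"
    and "LTmat P *v (\<omega>0 *\<^sub>R (J2 *v iT)) = - (RTmat P *v iT) + transpose (Emat P) *v v"
proof -
  have "Yl P v *v v = load_current P v"
    using wf by (auto simp: vec_eq_iff_block Yl_def load_current_def wf_power_system_def admittance_load_def)
  moreover have "kron (attach P) (mat 1) *v i_s = Iv P *v i"
  proof -
    have "stator_proj *v block k i = block k i_s" for k
      unfolding i_s[symmetric]
      by (simp add: vec_eq_iff stator_proj_mult_nth block_def stator_currents_def)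
    then show ?thesis
      unfolding Iv_def vec_eq_iff_block block_kron_mult by simp
  qed
  ultimately have "- (Iv P *v i) = load_current P v + \<omega>0 *\<^sub>R (J2 *v (Cmat P *v v)) + Emat P *v iT"
    using bal unfolding nodal_balance_def YN_def Yv_def iT
    by (simp del: transpose_matrix_vector add: matrix_vector_mult_add_rdistrib
        flip: matrix_vector_mul_assoc scaleR_matrix_vector_assoc)
  then show "Cmat P *v (\<omega>0 *\<^sub>R (J2 *v v)) = - (Iv P *v i) - Emat P *v iT - load_current P v"
    by (simp add: matrix_vector_mult_scaleR Cmat_J2)
  have "ZT P \<omega>0 *v iT = transpose (Emat P) *v v"
    using matrix_inv_mult_eq_iff[OF invertible_ZT[OF wf]] iT by metis
  then show "LTmat P *v (\<omega>0 *\<^sub>R (J2 *v iT)) = - (RTmat P *v iT) + transpose (Emat P) *v v"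
    by (simp del: transpose_matrix_vector add: ZT_def matrix_vector_mult_add_rdistrib
        matrix_vector_mult_scaleR LTmat_J2 algebra_simps
        flip: matrix_vector_mul_assoc scaleR_matrix_vector_assoc)
qed

text \<open>At synchronous speed the transformer term on the left cancels against half of the
  induced voltage. The damper rows then force \<open>i_d = i_q = 0\<close>, the field row fixes the
  excitation, and the stator rows become the equation for \<open>nu\<close>.\<close>

lemma machine_balance_iff:
  fixes P :: "('g::finite, 'v::finite, 't::finite) power_system"
  assumes wf: "wf_power_system P" and i_s: "stator_currents i = i_s" and \<omega>: "\<And>k. \<omega> $ k = \<omega>0"
  shows "Lmat P \<theta> *v (\<omega>0 *\<^sub>R (Jg *v i)) =
      - (Rmat P *v i) + transpose (Iv P) *v v + Isel_f *v vf - v_ind P \<theta> \<omega> i \<longleftrightarrow>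
    (\<forall>k. nu P \<omega>0 i_s v k (\<theta> $ k) = (\<omega>0 * lsf P k * i $ (k, Inr 1)) *\<^sub>R (jmat *v rvec (\<theta> $ k)) \<and>
        i $ (k, Inr 2) = 0 \<and> i $ (k, Inr 3) = 0 \<and> vf $ k = rf P k * i $ (k, Inr 1))"
    (is "?L = ?R \<longleftrightarrow> (\<forall>k. ?C k)")
proof -
  have "block k ?L = block k ?R \<longleftrightarrow> ?C k" for k
  proof -
    define z where "z = block k i"
    define w where "w = block (gen_bus P k) v"
    let ?A = "Lk P k (\<theta> $ k)"
    have z: "i $ (k, q) = z $ q" for q by (simp add: z_def block_def)
    have bs: "block k i_s $ a = z $ Inl a" for a
      by (simp add: z_def block_def stator_currents_def flip: i_s)
    have r: "rd P k \<noteq> 0" "rq P k \<noteq> 0"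
      using wf by (auto simp: wf_power_system_def less_imp_neq[THEN not_sym])
    have "block k ?L = \<omega>0 *\<^sub>R (?A *v (Jmat *v z))"
      by (simp add: Lmat_def Jg_def z_def matrix_vector_mult_scaleR)
    moreover have "block k ?R = - (Rk P k *v z) + transpose stator_proj *v w + vf $ k *\<^sub>R axis (Inr 1) 1
        - \<omega>0 *\<^sub>R (Jmat *v (?A *v z) - ?A *v (Jmat *v z))"
      by (simp del: transpose_matrix_vector add: Rmat_def block_transpose_Iv_mult block_Isel_f_mult
          v_ind_def \<omega> z_def w_def matrix_vector_mult_add_rdistrib transpose_Jmat_mult
          flip: matrix_vector_mul_assoc)
    \<comment> \<open>Skew-symmetry of \<open>Jmat\<close> turns the term with
      \<open>transpose Jmat\<close> into the one on the left, so only \<open>Jmat\<close> after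
      \<open>?A\<close> survives.\<close>
    ultimately have "block k ?L = block k ?R \<longleftrightarrow>
        Rk P k *v z + \<omega>0 *\<^sub>R (Jmat *v (?A *v z)) = transpose stator_proj *v w + vf $ k *\<^sub>R axis (Inr 1) 1"
      by (simp only:) (auto simp del: transpose_matrix_vector simp: algebra_simps)
    \<comment> \<open>Row by row; the rotor rows of the rotated flux vanish, and the positive damper
      resistances can be divided out.\<close>
    also have "\<dots> \<longleftrightarrow> ?C k"
      unfolding vec_Plus_eq_iff forall_2 forall_3 vec_eq_iff
      using r
      by (auto simp del: transpose_matrix_vector simp: transpose_stator_proj_mult_nth Rk_mult_nth
          Lk_mult_nth nu_def rvec_def vector_2 axis_def z bs matrix_vector_mult_add_rdistrib
          scaleR_mat_mult matrix_vector_mult_def[of "Ls _ _ _"] sum_2 Ls_nth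
          simp flip: matrix_vector_mul_assoc scaleR_matrix_vector_assoc w_def; algebra)
    finally show ?thesis .
  qed
  then show ?thesis by (simp only: vec_eq_iff_block)
qed

lemma rotor_balance_iff:
  "Mmat P *v 0 = - (Dmat P *v \<omega>) - torque P \<theta> i + \<tau>m \<longleftrightarrow>
    (\<forall>k. \<tau>m $ k = damping P k * \<omega> $ k + torque P \<theta> i $ k)"
proof -
  have D: "(Dmat P *v \<omega>) $ k = damping P k * \<omega> $ k" for k
    by (simp add: Dmat_def diag_mat_def matrix_vector_mult_def if_distrib[of "\<lambda>x. x * _"] cong: if_cong)
  show ?thesis by (auto simp: vec_eq_iff D algebra_simps)
qed

theorem theorem9:
  fixes P :: "('g::finite, 'v::finite, 't::finite) power_system"
    and \<omega>0 :: real
    and i_s :: "real ^ ('g \<times> 2)" and v :: "real ^ ('v \<times> 2)" and iT :: "real ^ ('t \<times> 2)"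
    and \<theta> \<omega> :: "real ^ 'g" and i :: "real ^ ('g \<times> (2 + 3))"
    and u :: "real \<Rightarrow> 'g input" and \<tau>m vf :: "real ^ 'g"
  assumes "wf_power_system P"
    and "(i_s, v) \<in> nodal_balance P \<omega>0"
    and "iT = matrix_inv (ZT P \<omega>0) *v (transpose (Emat P) *v v)"
    and "stator_currents i = i_s"
    and "u 0 = (\<tau>m, vf)"
  shows "operates_in_steady_state P \<omega>0 u (\<theta>, \<omega>, i, v, iT) \<longleftrightarrow>
    (\<forall>k. \<exists>\<sigma>\<in>{- 1, 1}.
        \<omega>0 * lsf P k * i $ (k, Inr 1) = \<sigma> * norm (nu P \<omega>0 i_s v k (\<theta> $ k)) \<and>
        norm (nu P \<omega>0 i_s v k (\<theta> $ k)) *\<^sub>R (jmat *v rvec (\<theta> $ k)) =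
          \<sigma> *\<^sub>R nu P \<omega>0 i_s v k (\<theta> $ k) \<and>
        \<omega> $ k = \<omega>0 \<and>
        i $ (k, Inr 2) = 0 \<and> i $ (k, Inr 3) = 0 \<and>
        vf $ k = rf P k * i $ (k, Inr 1) \<and>
        \<tau>m $ k = damping P k * \<omega>0 + torque P \<theta> i $ k) \<and>
    (\<forall>t\<ge>0. u t = u 0) \<and>
    (\<forall>k. \<exists>g b. admittance_load (iload P k) g b)"
proof -
  let ?\<nu> = "\<lambda>k. nu P \<omega>0 i_s v k (\<theta> $ k)" and ?e = "\<lambda>k. jmat *v rvec (\<theta> $ k)"
    and ?c = "\<lambda>k. \<omega>0 * lsf P k * i $ (k, Inr 1)"
  have "vector_field P (\<theta>, \<omega>, i, v, iT) (u 0) = sync_field \<omega>0 (\<theta>, \<omega>, i, v, iT) \<longleftrightarrow>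
      (\<forall>k. \<omega> $ k = \<omega>0) \<and>
      Mmat P *v 0 = - (Dmat P *v \<omega>) - torque P \<theta> i + \<tau>m \<and>
      Lmat P \<theta> *v (\<omega>0 *\<^sub>R (Jg *v i)) =
        - (Rmat P *v i) + transpose (Iv P) *v v + Isel_f *v vf - v_ind P \<theta> \<omega> i"
    unfolding sync_field_def prod.case assms(5) vector_field_eq_iff[OF assms(1)]
    using network_balance[OF assms(1-4)] by (auto simp: vec_eq_iff)
  \<comment> \<open>The speed condition comes first, as it allows \<open>\<omega>0\<close> to
    replace the speeds in the damping and in the induced voltage.\<close>
  also have "\<dots> \<longleftrightarrow> (\<forall>k. \<omega> $ k = \<omega>0 \<and> ?\<nu> k = ?c k *\<^sub>R ?e k \<and>
      i $ (k, Inr 2) = 0 \<and> i $ (k, Inr 3) = 0 \<and> vf $ k = rf P k * i $ (k, Inr 1) \<and>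
      \<tau>m $ k = damping P k * \<omega>0 + torque P \<theta> i $ k)"
    using machine_balance_iff[OF assms(1,4)] unfolding rotor_balance_iff by force
  finally have "operates_in_steady_state P \<omega>0 u (\<theta>, \<omega>, i, v, iT) \<longleftrightarrow> \<dots> \<and> (\<forall>t\<ge>0. u t = u 0)"
    unfolding operates_in_steady_state_iff[OF assms(1)] by simp
  \<comment> \<open>Witnessed by \<open>gload P k\<close> and \<open>bload P k\<close>.\<close>
  moreover have "\<exists>g b. admittance_load (iload P k) g b" for k
    using assms(1) unfolding wf_power_system_def by blast
  ultimately show ?thesis
    unfolding signed_norm_iff[OF norm_jmat_rvec, symmetric] by blast
qed

end
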